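(* Let $p$ be a computable real with $p\geq 1$ and $p\neq 2$, and let $C\subseteq\mathbb{N}$ be a c.e. set. Then there is an effective generating set $F$ for $\ell^p$ such that $C$ computes, with respect to $(E,F)$, a surjective linear isometry of $\ell^p$; and furthermore every oracle $X$ that computes, with respect to $(E,F)$, a surjective linear isometry of $\ell^p$ also computes $C$ (i.e. $C\le_T X$).
   Context: $\ell^p$ denotes the Banach space of all sequences $(a_n)_{n=0}^\infty$ of complex numbers with $\sum_{n}|a_n|^p<\infty$, with norm $(\sum_n|a_n|^p)^{1/p}$. For $n\in\mathbb{N}$, $e_n$ is the vector whose $(n+1)$st component is $1$ and all other components $0$; $E=\{e_0,e_1,\ldots\}$. A rational point is a complex number with rational real and imaginary parts. A generating set is a subset whose linear span is dense in $\ell^p$. A generating set $F=\{f_0,f_1,\ldots\}$ (given as a sequence) is an effective generating set if there is an algorithm that, given rational points $\alpha_0,\ldots,\alpha_M$ and $k\in\mathbb{N}$, computes a rational $q$ with $|q-\|\sum_{j=0}^M\alpha_jf_j\||<2^{-k}$. A rational ball with respect to $F$ is $B(\sum_{j=0}^M\alpha_jf_j;r)$ with $\alpha_j$ rational points and $r$ a positive rational (given to algorithms via a code of $(r,M,\alpha_0,\ldots,\alpha_M)$). For effective generating sets $F,G$ and an oracle $X$, $X$ computes a map $T:\ell^p\to\ell^p$ with respect to $(F,G)$ if there is an oracle algorithm $P$ using oracle $X$ such that: (Approximation) given a rational ball with respect to $F$, $P^X$ either does not halt or outputs a rational ball with respect to $G$; (Correctness) if $P^X$ on input $B_1$ outputs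 $B_2$ then $T(f)\in B_2$ for all $f\in B_1$; (Convergence) for every $f\in\ell^p$ and every neighborhood $U$ of $T(f)$ there is a rational ball $B_1$ with respect to $F$ containing $f$ on which $P^X$ halts and outputs a rational ball included in $U$. *)

theory Defs
  imports "HOL-Analysis.Analysis" "HOL-Library.Nat_Bijection" "HOL-Library.Function_Algebras"
begin

section \<open>Computability relative to an oracle\<close>

text \<open>
  Partial recursive functions relative to an oracle, in the unary formulation: several arguments
  are packed into one by the Cantor pairing function \<^const>\<open>prod_encode\<close>, and divergence is
  \<^const>\<open>None\<close>.
\<close>

definition pair_op :: "(nat \<rightharpoonup> nat) \<Rightarrow> (nat \<rightharpoonup> nat) \<Rightarrow> (nat \<rightharpoonup> nat)" where
  "pair_op f g n =
     Option.bind (f n) (\<lambda>a. Option.bind (g n) (\<lambda>b. Some (prod_encode (a, b))))"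

text \<open>Primitive recursion: \<open>h(a, 0) = f(a)\<close> and \<open>h(a, y + 1) = g(a, (y, h(a, y)))\<close>.\<close>

definition prec_op :: "(nat \<rightharpoonup> nat) \<Rightarrow> (nat \<rightharpoonup> nat) \<Rightarrow> (nat \<rightharpoonup> nat)" where
  "prec_op f g n = (case prod_decode n of (a, m) \<Rightarrow>
     rec_nat (f a)
       (\<lambda>y h. Option.bind h (\<lambda>i. g (prod_encode (a, prod_encode (y, i))))) m)"

text \<open>Unbounded search: it diverges if \<open>f(a, k)\<close> does for some \<open>k\<close> before the first zero.\<close>

definition mu_op :: "(nat \<rightharpoonup> nat) \<Rightarrow> (nat \<rightharpoonup> nat)" where
  "mu_op f a =
     (if \<exists>m. f (prod_encode (a, m)) = Some 0 \<and> (\<forall>k<m. \<exists>v. f (prod_encode (a, k)) = Some (Suc v))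
      then Some (LEAST m. f (prod_encode (a, m)) = Some 0) else None)"

inductive partrec_in :: "nat set \<Rightarrow> (nat \<rightharpoonup> nat) \<Rightarrow> bool" for X :: "nat set" where
  zero: "partrec_in X (\<lambda>_. Some 0)"
| succ: "partrec_in X (\<lambda>n. Some (Suc n))"
| left: "partrec_in X (\<lambda>n. Some (fst (prod_decode n)))"
| right: "partrec_in X (\<lambda>n. Some (snd (prod_decode n)))"
| query: "partrec_in X (\<lambda>n. Some (of_bool (n \<in> X)))"
| pair: "partrec_in X f \<Longrightarrow> partrec_in X g \<Longrightarrow> partrec_in X (pair_op f g)"
| comp: "partrec_in X f \<Longrightarrow> partrec_in X g \<Longrightarrow> partrec_in X (f \<circ>\<^sub>m g)"
| prec: "partrec_in X f \<Longrightarrow> partrec_in X g \<Longrightarrow> partrec_in X (prec_op f g)"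
| mu: "partrec_in X f \<Longrightarrow> partrec_in X (mu_op f)"

abbreviation partrec :: "(nat \<rightharpoonup> nat) \<Rightarrow> bool" where
  "partrec \<equiv> partrec_in {}"

definition ce :: "nat set \<Rightarrow> bool" where
  "ce C \<longleftrightarrow> (\<exists>\<phi>. partrec \<phi> \<and> C = dom \<phi>)"

definition turing_reducible :: "nat set \<Rightarrow> nat set \<Rightarrow> bool"  (infix \<open>\<le>\<^sub>T\<close> 50) where
  "C \<le>\<^sub>T X \<longleftrightarrow> partrec_in X (\<lambda>n. Some (of_bool (n \<in> C)))"


section \<open>Codes of rational data\<close>

text \<open>
  The decoding functions below are total and surjective onto the objects they code (they are not
  injective, since fractions need not be reduced), so an algorithm that is given, or outputs, an
  object of one of these kinds is a partial function on, or into, all of \<^typ>\<open>nat\<close>.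
\<close>

definition rat_decode :: "nat \<Rightarrow> rat" where
  "rat_decode n = (case prod_decode n of (a, b) \<Rightarrow> of_int (int_decode a) / of_nat (Suc b))"

definition pos_rat_decode :: "nat \<Rightarrow> rat" where
  "pos_rat_decode n = (case prod_decode n of (a, b) \<Rightarrow> of_nat (Suc a) / of_nat (Suc b))"

definition point_decode :: "nat \<Rightarrow> complex" where
  "point_decode n = (case prod_decode n of (a, b) \<Rightarrow>
     Complex (of_rat (rat_decode a)) (of_rat (rat_decode b)))"

text \<open>
  A code of the rational points \<open>\<alpha>\<^sub>0, \<dots>, \<alpha>\<^sub>M\<close> is a pair of a code of \<open>\<alpha>\<^sub>0\<close> and a
  \<^const>\<open>list_encode\<close> code of the possibly empty rest; \<open>M\<close> is the length of the latter.
\<close>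

definition points_decode :: "nat \<Rightarrow> complex list" where
  "points_decode n = (case prod_decode n of (a, l) \<Rightarrow>
     point_decode a # map point_decode (list_decode l))"

lemma rat_decode_surj: "\<exists>n. rat_decode n = q"
proof -
  obtain a b where q: "q = Fract a b" "b > 0"
    by (cases q) auto
  have "rat_decode (prod_encode (int_encode a, nat b - 1)) = q"
    using q by (simp add: rat_decode_def Fract_of_int_quotient of_nat_diff)
  then show ?thesis ..
qed

lemma pos_rat_decode_surj: "range pos_rat_decode = {q. q > 0}"
proof (intro equalityI subsetI)
  fix q assume "q \<in> {q :: rat. q > 0}"
  moreover obtain a b where q: "q = Fract a b" "b > 0"
    by (cases q) auto
  ultimately have "a > 0"
    by (simp add: zero_less_Fract_iff)
  with q have "pos_rat_decode (prod_encode (nat a - 1, nat b - 1)) = q"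
    by (simp add: pos_rat_decode_def Fract_of_int_quotient of_nat_diff)
  then show "q \<in> range pos_rat_decode"
    by (metis rangeI)
qed (auto simp: pos_rat_decode_def split: prod.splits)

lemma range_point_decode: "range point_decode = {z. Re z \<in> \<rat> \<and> Im z \<in> \<rat>}"
proof (intro equalityI subsetI)
  fix z assume "z \<in> {z. Re z \<in> \<rat> \<and> Im z \<in> \<rat>}"
  then obtain q r where "Re z = of_rat q" "Im z = of_rat r"
    by (auto elim!: Rats_cases)
  moreover obtain a b where "rat_decode a = q" "rat_decode b = r"
    using rat_decode_surj by metis
  ultimately have "point_decode (prod_encode (a, b)) = z"
    by (simp add: point_decode_def complex_eq_iff)
  then show "z \<in> range point_decode"
    by (metis rangeI)
qed (auto simp: point_decode_def split: prod.splits)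

lemma range_points_decode:
  "range points_decode = {\<alpha>. \<alpha> \<noteq> [] \<and> (\<forall>z \<in> set \<alpha>. Re z \<in> \<rat> \<and> Im z \<in> \<rat>)}"
proof (intro equalityI subsetI)
  fix \<alpha> :: "complex list"
  assume \<alpha>: "\<alpha> \<in> {\<alpha>. \<alpha> \<noteq> [] \<and> (\<forall>z \<in> set \<alpha>. Re z \<in> \<rat> \<and> Im z \<in> \<rat>)}"
  then have "\<forall>z \<in> set \<alpha>. z \<in> range point_decode"
    unfolding range_point_decode by auto
  then have "\<exists>ns. map point_decode ns = \<alpha>"
    by (metis ex_map_conv rangeE)
  with \<alpha> obtain n ns where "point_decode n # map point_decode ns = \<alpha>"
    by (metis (mono_tags, lifting) list.exhaust list.map(1,2) mem_Collect_eq)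
  then have "points_decode (prod_encode (n, list_encode ns)) = \<alpha>"
    by (simp add: points_decode_def)
  then show "\<alpha> \<in> range points_decode"
    by (metis rangeI)
next
  fix \<alpha> :: "complex list"
  assume "\<alpha> \<in> range points_decode"
  moreover have "point_decode n \<in> {z. Re z \<in> \<rat> \<and> Im z \<in> \<rat>}" for n
    using range_point_decode by blast
  ultimately show "\<alpha> \<in> {\<alpha>. \<alpha> \<noteq> [] \<and> (\<forall>z \<in> set \<alpha>. Re z \<in> \<rat> \<and> Im z \<in> \<rat>)}"
    by (auto simp: points_decode_def split: prod.splits)
qed

definition computable_real :: "real \<Rightarrow> bool" where
  "computable_real x \<longleftrightarrow>
     (\<exists>\<phi>. partrec \<phi> \<and> (\<forall>k. \<exists>m. \<phi> k = Some m \<and> \<bar>of_rat (rat_decode m) - x\<bar> < 1 / 2 ^ k))"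


section \<open>The space \<open>\<ell>\<^sup>p\<close>\<close>

definition lp :: "real \<Rightarrow> (nat \<Rightarrow> complex) set" where
  "lp p = {a. summable (\<lambda>n. cmod (a n) powr p)}"

definition lp_norm :: "real \<Rightarrow> (nat \<Rightarrow> complex) \<Rightarrow> real" where
  "lp_norm p a = (\<Sum>n. cmod (a n) powr p) powr (1 / p)"

definition lp_ball :: "real \<Rightarrow> (nat \<Rightarrow> complex) \<Rightarrow> real \<Rightarrow> (nat \<Rightarrow> complex) set" where
  "lp_ball p a r = {f \<in> lp p. lp_norm p (f - a) < r}"

definition cscale :: "complex \<Rightarrow> (nat \<Rightarrow> complex) \<Rightarrow> (nat \<Rightarrow> complex)" where
  "cscale c a = (\<lambda>n. c * a n)"

interpretation cseq: vector_space cscale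
  by unfold_locales (auto simp: cscale_def algebra_simps)

definition std_basis :: "nat \<Rightarrow> nat \<Rightarrow> complex" where
  "std_basis n = (\<lambda>i. of_bool (i = n))"

definition surj_linear_isometry :: "real \<Rightarrow> ((nat \<Rightarrow> complex) \<Rightarrow> (nat \<Rightarrow> complex)) \<Rightarrow> bool" where
  "surj_linear_isometry p T \<longleftrightarrow>
     T ` lp p = lp p \<and>
     (\<forall>f \<in> lp p. \<forall>g \<in> lp p. T (f + g) = T f + T g) \<and>
     (\<forall>c. \<forall>f \<in> lp p. T (cscale c f) = cscale c (T f)) \<and>
     (\<forall>f \<in> lp p. \<forall>g \<in> lp p. lp_norm p (T f - T g) = lp_norm p (f - g))"


section \<open>Effective generating sets and computable maps\<close>

definition generating_set :: "real \<Rightarrow> (nat \<Rightarrow> nat \<Rightarrow> complex) \<Rightarrow> bool" where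
  "generating_set p F \<longleftrightarrow>
     range F \<subseteq> lp p \<and>
     (\<forall>a \<in> lp p. \<forall>\<epsilon>>0. \<exists>b \<in> cseq.span (range F). lp_norm p (a - b) < \<epsilon>)"

definition lincomb :: "(nat \<Rightarrow> nat \<Rightarrow> complex) \<Rightarrow> complex list \<Rightarrow> (nat \<Rightarrow> complex)" where
  "lincomb F \<alpha> = (\<Sum>j<length \<alpha>. cscale (\<alpha> ! j) (F j))"

definition effective_generating_set :: "real \<Rightarrow> (nat \<Rightarrow> nat \<Rightarrow> complex) \<Rightarrow> bool" where
  "effective_generating_set p F \<longleftrightarrow>
     generating_set p F \<and>
     (\<exists>\<phi>. partrec \<phi> \<and>
        (\<forall>c k. \<exists>m. \<phi> (prod_encode (c, k)) = Some m \<and>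
           \<bar>of_rat (rat_decode m) - lp_norm p (lincomb F (points_decode c))\<bar> < 1 / 2 ^ k))"

text \<open>The rational ball with respect to \<open>F\<close> coded by \<open>b\<close>.\<close>

definition rational_ball :: "real \<Rightarrow> (nat \<Rightarrow> nat \<Rightarrow> complex) \<Rightarrow> nat \<Rightarrow> (nat \<Rightarrow> complex) set" where
  "rational_ball p F b = (case prod_decode b of (r, c) \<Rightarrow>
     lp_ball p (lincomb F (points_decode c)) (of_rat (pos_rat_decode r)))"

text \<open>
  Since every natural number codes a rational ball, the approximation requirement is the type of
  \<open>\<phi>\<close>; the two conjuncts about \<open>\<phi>\<close> are correctness and convergence.
\<close>

definition computes_map ::
    "real \<Rightarrow> nat set \<Rightarrow> (nat \<Rightarrow> nat \<Rightarrow> complex) \<Rightarrow> (nat \<Rightarrow> nat \<Rightarrow> complex) \<Rightarrow>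
     ((nat \<Rightarrow> complex) \<Rightarrow> (nat \<Rightarrow> complex)) \<Rightarrow> bool" where
  "computes_map p X F G T \<longleftrightarrow>
     (\<exists>\<phi>. partrec_in X \<phi> \<and>
        (\<forall>b b'. \<phi> b = Some b' \<longrightarrow> (\<forall>f \<in> rational_ball p F b. T f \<in> rational_ball p G b')) \<and>
        (\<forall>f \<in> lp p. \<forall>U. (\<exists>\<epsilon>>0. lp_ball p (T f) \<epsilon> \<subseteq> U) \<longrightarrow>
           (\<exists>b b'. f \<in> rational_ball p F b \<and> \<phi> b = Some b' \<and> rational_ball p G b' \<subseteq> U)))"

end

theory Submission
  imports Defs
begin

text \<open>
  Split \<open>C\<close> into stages \<open>s = (n, m)\<close>, giving \<open>s\<close> the weight \<open>w\<^sub>s = 2\<^sup>-\<^sup>(\<^sup>n\<^sup>+\<^sup>2\<^sup>)\<close> if \<open>m\<close> is the first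
  witness of \<open>n \<in> C\<close> and \<open>0\<close> otherwise, and let \<open>\<gamma> = \<Sum>\<^sub>s w\<^sub>s\<^sup>p\<close>. The generating set is
  \<open>f\<^sub>0 = (1 - \<gamma>)\<^sup>1\<^sup>/\<^sup>p e\<^sub>0 + \<Sum>\<^sub>s w\<^sub>s e\<^sub>s\<^sub>+\<^sub>1\<close>, \<open>f\<^sub>s\<^sub>+\<^sub>1 = e\<^sub>s\<^sub>+\<^sub>1\<close>. Since \<open>f\<^sub>0\<close> is a unit vector, the norm of a
  rational combination involves only finitely many weights, so it is computable although \<open>\<gamma>\<close> need not be.
  With \<open>C\<close> as oracle one can bound the tail of the series \<open>\<gamma>\<close>, hence approximate \<open>e\<^sub>0\<close> by
  combinations of the \<open>f\<^sub>j\<close>, which makes the identity map computable. Conversely, for \<open>p \<noteq> 2\<close> a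
  linear isometry preserves disjointness of supports (equality case of the Clarkson-type
  parallelogram inequalities), so a surjective one maps some \<open>e\<^sub>j\<close> to a unimodular multiple of
  \<open>e\<^sub>0\<close>. Every approximation of that image by the \<open>f\<^sub>j\<close> has its \<open>f\<^sub>0\<close>-coefficient close to
  \<open>(1 - \<gamma>)\<^sup>-\<^sup>1\<^sup>/\<^sup>p\<close> in modulus, which bounds \<open>\<gamma>\<close> from above and so lets one enumerate the
  complement of \<open>C\<close>.

  Algorithms are obtained by searching for witnesses of semidecidable relations, which are closed
  under existential and bounded universal quantification; reals enter only through their cuts.
\<close>

section \<open>Computable functions and semidecidable predicates\<close>

abbreviation pfst :: "nat \<Rightarrow> nat" where "pfst n \<equiv> fst (prod_decode n)"
abbreviation psnd :: "nat \<Rightarrow> nat" where "psnd n \<equiv> snd (prod_decode n)"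

named_theorems comp_intro

definition computable_in :: "nat set \<Rightarrow> (nat \<Rightarrow> nat) \<Rightarrow> bool" where
  "computable_in X f \<longleftrightarrow> partrec_in X (\<lambda>n. Some (f n))"

lemma computable_in_id [comp_intro]: "computable_in X (\<lambda>n. n)"
proof -
  have "pair_op (\<lambda>n. Some (pfst n)) (\<lambda>n. Some (psnd n)) = (\<lambda>n. Some n)"
    by (rule ext) (simp add: pair_op_def)
  with partrec_in.pair[OF partrec_in.left partrec_in.right] show ?thesis
    unfolding computable_in_def by metis
qed

lemma computable_in_comp:
  assumes "computable_in X h" "computable_in X f"
  shows "computable_in X (\<lambda>n. h (f n))"
  using partrec_in.comp[OF assms[unfolded computable_in_def]]
  by (simp add: computable_in_def map_comp_def)

lemma computable_in_Suc [comp_intro]: "computable_in X f \<Longrightarrow> computable_in X (\<lambda>n. Suc (f n))"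
  by (rule computable_in_comp) (simp_all add: computable_in_def partrec_in.succ)

lemma computable_in_pfst [comp_intro]: "computable_in X f \<Longrightarrow> computable_in X (\<lambda>n. pfst (f n))"
  by (rule computable_in_comp) (simp_all add: computable_in_def partrec_in.left)

lemma computable_in_psnd [comp_intro]: "computable_in X f \<Longrightarrow> computable_in X (\<lambda>n. psnd (f n))"
  by (rule computable_in_comp) (simp_all add: computable_in_def partrec_in.right)

lemma computable_in_const [comp_intro]: "computable_in X (\<lambda>n. c)"
proof (induction c)
  case 0
  show ?case by (simp add: computable_in_def partrec_in.zero)
qed (rule computable_in_Suc)

lemma computable_in_pair [comp_intro]:
  assumes "computable_in X f" "computable_in X g"
  shows "computable_in X (\<lambda>n. prod_encode (f n, g n))"
  using partrec_in.pair[OF assms[unfolded computable_in_def]]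
  by (simp add: computable_in_def pair_op_def[abs_def])

text \<open>Functions of several arguments enter this unary setting uncurried, through
  \<open>pfst\<close> and \<open>psnd\<close>. The \<open>comp2\<close> rules pass back to curried
  application, and rules with a bound variable state their premises in the same uncurried
  form.\<close>

lemma computable_in_comp2:
  assumes "computable_in X (\<lambda>w. h (pfst w) (psnd w))" "computable_in X f" "computable_in X g"
  shows "computable_in X (\<lambda>n. h (f n) (g n))"
  using computable_in_comp[OF assms(1) computable_in_pair[OF assms(2,3)]] by simp

text \<open>The parameter \<open>n\<close> travels unchanged through the recursion as the first
  component of the packed argument. The arithmetic operations that follow are all instances of this
  rule.\<close>

lemma computable_in_rec_nat [comp_intro]:
  assumes "computable_in X f"
    and "computable_in X (\<lambda>w. g (pfst w) (pfst (psnd w)) (psnd (psnd w)))"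
    and "computable_in X m"
  shows "computable_in X (\<lambda>n. rec_nat (f n) (g n) (m n))"
proof -
  let ?F = "\<lambda>n. Some (f n)" and ?G = "\<lambda>w. Some (g (pfst w) (pfst (psnd w)) (psnd (psnd w)))"
  have "partrec_in X (prec_op ?F ?G)"
    using assms(1,2) unfolding computable_in_def by (rule partrec_in.prec)
  moreover have "prec_op ?F ?G = (\<lambda>w. Some (rec_nat (f (pfst w)) (g (pfst w)) (psnd w)))"
  proof
    fix w
    have "rec_nat (?F a) (\<lambda>y h. Option.bind h (\<lambda>i. ?G (prod_encode (a, prod_encode (y, i))))) k
        = Some (rec_nat (f a) (g a) k)" for a k
      by (induction k) auto
    then show "prec_op ?F ?G w = Some (rec_nat (f (pfst w)) (g (pfst w)) (psnd w))"
      by (simp add: prec_op_def split_def)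
  qed
  ultimately have "computable_in X (\<lambda>w. rec_nat (f (pfst w)) (g (pfst w)) (psnd w))"
    unfolding computable_in_def by simp
  from computable_in_comp2[where h = "\<lambda>a k. rec_nat (f a) (g a) k", OF this computable_in_id assms(3)]
  show ?thesis .
qed

lemma computable_in_add [comp_intro]:
  assumes "computable_in X f" "computable_in X g"
  shows "computable_in X (\<lambda>n. f n + g n)"
proof -
  have "rec_nat a (\<lambda>_ h. Suc h) k = a + k" for a k by (induction k) auto
  moreover have "computable_in X (\<lambda>n. rec_nat (f n) (\<lambda>_ h. Suc h) (g n))"
    by (intro comp_intro assms)
  ultimately show ?thesis by simp
qed

lemma computable_in_mult [comp_intro]:
  assumes "computable_in X f" "computable_in X g"
  shows "computable_in X (\<lambda>n. f n * g n)"
proof -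
  have "rec_nat 0 (\<lambda>_ h. h + a) k = a * k" for a k :: nat by (induction k) auto
  moreover have "computable_in X (\<lambda>n. rec_nat 0 (\<lambda>_ h. h + f n) (g n))"
    by (intro comp_intro assms computable_in_comp[OF assms(1)])
  ultimately show ?thesis by simp
qed

lemma computable_in_power [comp_intro]:
  assumes "computable_in X f" "computable_in X g"
  shows "computable_in X (\<lambda>n. f n ^ g n)"
proof -
  have "rec_nat 1 (\<lambda>_ h. h * a) k = a ^ k" for a k :: nat by (induction k) auto
  moreover have "computable_in X (\<lambda>n. rec_nat 1 (\<lambda>_ h. h * f n) (g n))"
    by (intro comp_intro assms computable_in_comp[OF assms(1)])
  ultimately show ?thesis by simp
qed

lemma computable_in_diff [comp_intro]:
  assumes "computable_in X f" "computable_in X g"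
  shows "computable_in X (\<lambda>n. f n - g n)"
proof -
  \<comment> \<open>Recursion that returns its counter is the predecessor; iterating it gives
    truncated subtraction.\<close>
  have pred: "rec_nat 0 (\<lambda>y _. y) k = k - 1" for k :: nat by (cases k) auto
  have "rec_nat a (\<lambda>_ h. rec_nat 0 (\<lambda>y _. y) h) k = a - k" for a k :: nat
    by (induction k) (auto simp: pred)
  moreover have "computable_in X (\<lambda>n. rec_nat (f n) (\<lambda>_ h. rec_nat 0 (\<lambda>y _. y) h) (g n))"
    by (intro comp_intro assms)
  ultimately show ?thesis by simp
qed

section \<open>Decidable predicates and bounded quantifiers\<close>

definition decidable_in :: "nat set \<Rightarrow> (nat \<Rightarrow> bool) \<Rightarrow> bool" where
  "decidable_in X P \<longleftrightarrow> computable_in X (\<lambda>n. of_bool (P n))"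

lemma computable_in_of_bool [comp_intro]:
  "decidable_in X P \<Longrightarrow> computable_in X (\<lambda>n. of_bool (P n))"
  by (simp add: decidable_in_def)

lemma decidable_in_comp: "decidable_in X P \<Longrightarrow> computable_in X f \<Longrightarrow> decidable_in X (\<lambda>n. P (f n))"
  unfolding decidable_in_def by (rule computable_in_comp)

lemma decidable_in_mem [comp_intro]:
  "computable_in X f \<Longrightarrow> decidable_in X (\<lambda>n. f n \<in> X)"
  by (rule decidable_in_comp[where P = "\<lambda>n. n \<in> X"])
    (simp_all add: decidable_in_def computable_in_def partrec_in.query)

lemma decidable_in_not [comp_intro]:
  assumes "decidable_in X P"
  shows "decidable_in X (\<lambda>n. \<not> P n)"
proof -
  have eq: "of_bool (\<not> P n) = (1 - of_bool (P n) :: nat)" for n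
    by auto
  show ?thesis
    unfolding decidable_in_def eq by (intro comp_intro assms)
qed

lemma decidable_in_conj [comp_intro]:
  assumes "decidable_in X P" "decidable_in X Q"
  shows "decidable_in X (\<lambda>n. P n \<and> Q n)"
proof -
  have "computable_in X (\<lambda>n. of_bool (P n) * of_bool (Q n))"
    by (intro comp_intro assms)
  then show ?thesis
    by (simp add: decidable_in_def of_bool_conj)
qed

lemma decidable_in_disj [comp_intro]:
  assumes "decidable_in X P" "decidable_in X Q"
  shows "decidable_in X (\<lambda>n. P n \<or> Q n)"
proof -
  have "decidable_in X (\<lambda>n. \<not> (\<not> P n \<and> \<not> Q n))"
    by (intro comp_intro assms)
  then show ?thesis by simp
qed

lemma decidable_in_imp [comp_intro]:
  assumes "decidable_in X P" "decidable_in X Q"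
  shows "decidable_in X (\<lambda>n. P n \<longrightarrow> Q n)"
proof -
  have "decidable_in X (\<lambda>n. \<not> P n \<or> Q n)"
    by (intro comp_intro assms)
  then show ?thesis by simp
qed

lemma decidable_in_nat_le [comp_intro]:
  fixes f g :: "nat \<Rightarrow> nat"
  assumes "computable_in X f" "computable_in X g"
  shows "decidable_in X (\<lambda>n. f n \<le> g n)"
proof -
  have eq: "of_bool (f n \<le> g n) = 1 - (f n - g n)" for n
    by auto
  show ?thesis
    unfolding decidable_in_def eq by (intro comp_intro assms)
qed

lemma decidable_in_nat_less [comp_intro]:
  fixes f g :: "nat \<Rightarrow> nat"
  assumes "computable_in X f" "computable_in X g"
  shows "decidable_in X (\<lambda>n. f n < g n)"
proof -
  have "decidable_in X (\<lambda>n. Suc (f n) \<le> g n)"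
    by (intro comp_intro assms)
  then show ?thesis by (simp add: Suc_le_eq)
qed

lemma decidable_in_nat_eq [comp_intro]:
  fixes f g :: "nat \<Rightarrow> nat"
  assumes "computable_in X f" "computable_in X g"
  shows "decidable_in X (\<lambda>n. f n = g n)"
proof -
  have "decidable_in X (\<lambda>n. f n \<le> g n \<and> g n \<le> f n)"
    by (intro comp_intro assms)
  then show ?thesis by (simp add: eq_iff)
qed

lemma computable_in_if [comp_intro]:
  assumes "decidable_in X P" "computable_in X f" "computable_in X g"
  shows "computable_in X (\<lambda>n. if P n then f n else g n)"
proof -
  have eq: "(if P n then f n else g n) = of_bool (P n) * f n + of_bool (\<not> P n) * g n" for n
    by auto
  show ?thesis
    unfolding eq by (intro comp_intro assms)
qed

lemma decidable_in_all_less [comp_intro]: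
  assumes "decidable_in X (\<lambda>w. P (pfst w) (psnd w))" "computable_in X m"
  shows "decidable_in X (\<lambda>n. \<forall>i<m n. P n i)"
proof -
  \<comment> \<open>A bounded universal quantifier is the product of the truth values.\<close>
  have "computable_in X (\<lambda>n. rec_nat 1 (\<lambda>i h. h * of_bool (P n i)) (m n))"
    by (intro comp_intro assms
        decidable_in_comp[OF assms(1), where f = "\<lambda>w. prod_encode (pfst w, pfst (psnd w))", simplified])
  moreover have "rec_nat 1 (\<lambda>i h. h * of_bool (Q i)) k = (of_bool (\<forall>i<k. Q i) :: nat)" for Q k
    by (induction k) (auto simp: less_Suc_eq)
  ultimately show ?thesis by (simp add: decidable_in_def)
qed

lemma decidable_in_ex_less [comp_intro]:
  assumes "decidable_in X (\<lambda>w. P (pfst w) (psnd w))" "computable_in X m"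
  shows "decidable_in X (\<lambda>n. \<exists>i<m n. P n i)"
proof -
  have "decidable_in X (\<lambda>n. \<not> (\<forall>i<m n. \<not> P n i))"
    by (intro comp_intro assms)
  then show ?thesis by simp
qed

text \<open>The searched function is total and vanishes exactly where \<open>P\<close> holds, so the
  definedness clause of \<open>mu_op\<close> is automatic and the search becomes a least-number
  operator.\<close>

lemma mu_op_decidable:
  "mu_op (\<lambda>w. Some (of_bool (\<not> P (pfst w) (psnd w)))) a =
     (if \<exists>m. P a m then Some (LEAST m. P a m) else None)"
proof (cases "\<exists>m. P a m")
  case True
  have "P a (LEAST m. P a m)" using True by (rule LeastI_ex)
  moreover have "\<forall>k<LEAST m. P a m. \<not> P a k" by (auto dest: not_less_Least)
  ultimately have "\<exists>m. P a m \<and> (\<forall>k<m. \<not> P a k)" by blast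
  with True show ?thesis by (simp add: mu_op_def) blast
next
  case False
  then show ?thesis by (simp add: mu_op_def)
qed

lemma computable_in_Least:
  assumes "decidable_in X (\<lambda>w. P (pfst w) (psnd w))" "\<And>n. \<exists>m. P n m"
  shows "computable_in X (\<lambda>n. LEAST m. P n m)"
proof -
  have "partrec_in X (mu_op (\<lambda>w. Some (of_bool (\<not> P (pfst w) (psnd w)))))"
    using decidable_in_not[OF assms(1)] unfolding decidable_in_def computable_in_def
    by (rule partrec_in.mu)
  then show ?thesis
    using assms(2) by (simp add: mu_op_decidable[abs_def] computable_in_def)
qed

section \<open>Semidecidable predicates as projections of decidable relations\<close>

definition semidecidable_in :: "nat set \<Rightarrow> (nat \<Rightarrow> bool) \<Rightarrow> bool" where
  "semidecidable_in X P \<longleftrightarrow>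
     (\<exists>R. decidable_in X (\<lambda>w. R (pfst w) (psnd w)) \<and> (\<forall>n. P n \<longleftrightarrow> (\<exists>m. R n m)))"

lemma semidecidable_in_decidable:
  assumes "decidable_in X P"
  shows "semidecidable_in X P"
  unfolding semidecidable_in_def
  by (rule exI[of _ "\<lambda>n m. P n"]) (simp add: decidable_in_comp[OF assms] comp_intro)

lemma semidecidable_in_comp:
  assumes "semidecidable_in X P" "computable_in X f"
  shows "semidecidable_in X (\<lambda>n. P (f n))"
proof -
  obtain R where R: "decidable_in X (\<lambda>w. R (pfst w) (psnd w))" "\<And>n. P n \<longleftrightarrow> (\<exists>m. R n m)"
    using assms(1) unfolding semidecidable_in_def by auto
  have "decidable_in X (\<lambda>w. R (f (pfst w)) (psnd w))"
    using decidable_in_comp[OF R(1), of "\<lambda>w. prod_encode (f (pfst w), psnd w)"]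
    by (simp add: comp_intro computable_in_comp[OF assms(2)])
  then show ?thesis
    unfolding semidecidable_in_def using R(2) by (intro exI[of _ "\<lambda>n m. R (f n) m"]) auto
qed

lemma semidecidable_in_comp2:
  assumes "semidecidable_in X (\<lambda>w. P (pfst w) (psnd w))" "computable_in X f" "computable_in X g"
  shows "semidecidable_in X (\<lambda>n. P (f n) (g n))"
  using semidecidable_in_comp[OF assms(1) computable_in_pair[OF assms(2,3)]] by simp

lemma decidable_in_comp2:
  assumes "decidable_in X (\<lambda>w. P (pfst w) (psnd w))" "computable_in X f" "computable_in X g"
  shows "decidable_in X (\<lambda>n. P (f n) (g n))"
  using decidable_in_comp[OF assms(1) computable_in_pair[OF assms(2,3)]] by simp

text \<open>The quantified number and its certificate are merged into a single witness by
  pairing.\<close>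

lemma semidecidable_in_ex [comp_intro]:
  assumes "semidecidable_in X (\<lambda>w. P (pfst w) (psnd w))"
  shows "semidecidable_in X (\<lambda>n. \<exists>m. P n m)"
proof -
  obtain R where R: "decidable_in X (\<lambda>w. R (pfst w) (psnd w))"
      "\<And>n. P (pfst n) (psnd n) \<longleftrightarrow> (\<exists>m. R n m)"
    using assms(1) unfolding semidecidable_in_def by auto
  have "decidable_in X (\<lambda>w. R (prod_encode (pfst w, pfst (psnd w))) (psnd (psnd w)))"
    by (intro decidable_in_comp2[OF R(1)] comp_intro)
  moreover have "(\<exists>m. P n m) \<longleftrightarrow> (\<exists>u. R (prod_encode (n, pfst u)) (psnd u))" for n
    by (metis R(2) fst_conv snd_conv prod_encode_inverse)
  ultimately show ?thesis
    unfolding semidecidable_in_def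
    by (intro exI[of _ "\<lambda>n u. R (prod_encode (n, pfst u)) (psnd u)"]) auto
qed

lemma semidecidable_in_conj [comp_intro]:
  assumes "semidecidable_in X P" "semidecidable_in X Q"
  shows "semidecidable_in X (\<lambda>n. P n \<and> Q n)"
proof -
  obtain R where R: "decidable_in X (\<lambda>w. R (pfst w) (psnd w))" "\<And>n. P n \<longleftrightarrow> (\<exists>m. R n m)"
    using assms(1) unfolding semidecidable_in_def by auto
  obtain S where S: "decidable_in X (\<lambda>w. S (pfst w) (psnd w))" "\<And>n. Q n \<longleftrightarrow> (\<exists>m. S n m)"
    using assms(2) unfolding semidecidable_in_def by auto
  have "semidecidable_in X (\<lambda>n. \<exists>k. \<exists>l. R n k \<and> S n l)"
    by (intro comp_intro semidecidable_in_decidable decidable_in_comp2[OF R(1)] decidable_in_comp2[OF S(1)])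
  then show ?thesis by (simp add: R(2) S(2))
qed

lemma semidecidable_in_disj [comp_intro]:
  assumes "semidecidable_in X P" "semidecidable_in X Q"
  shows "semidecidable_in X (\<lambda>n. P n \<or> Q n)"
proof -
  obtain R where R: "decidable_in X (\<lambda>w. R (pfst w) (psnd w))" "\<And>n. P n \<longleftrightarrow> (\<exists>m. R n m)"
    using assms(1) unfolding semidecidable_in_def by auto
  obtain S where S: "decidable_in X (\<lambda>w. S (pfst w) (psnd w))" "\<And>n. Q n \<longleftrightarrow> (\<exists>m. S n m)"
    using assms(2) unfolding semidecidable_in_def by auto
  have "semidecidable_in X (\<lambda>n. \<exists>k. R n k \<or> S n k)"
    by (intro comp_intro semidecidable_in_decidable decidable_in_comp2[OF R(1)] decidable_in_comp2[OF S(1)])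
  then show ?thesis by (simp add: R(2) S(2) ex_disj_distrib)
qed

text \<open>Finitely many witnesses have a common bound \<open>b\<close>, so the unbounded search
  can be moved in front of the bounded quantifier.\<close>

lemma semidecidable_in_all_less [comp_intro]:
  assumes "semidecidable_in X (\<lambda>w. P (pfst w) (psnd w))" "computable_in X m"
  shows "semidecidable_in X (\<lambda>n. \<forall>i<m n. P n i)"
proof -
  obtain R where R: "decidable_in X (\<lambda>w. R (pfst w) (psnd w))"
      "\<And>n. P (pfst n) (psnd n) \<longleftrightarrow> (\<exists>m. R n m)"
    using assms(1) unfolding semidecidable_in_def by auto
  have "semidecidable_in X (\<lambda>n. \<exists>b. \<forall>i<m n. \<exists>k<b. R (prod_encode (n, i)) k)"
    by (intro comp_intro semidecidable_in_decidable decidable_in_comp2[OF R(1)] computable_in_comp[OF assms(2)])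
  moreover have "(\<exists>b. \<forall>i<m n. \<exists>k<b. R (prod_encode (n, i)) k) \<longleftrightarrow> (\<forall>i<m n. P n i)" for n
  proof
    assume "\<forall>i<m n. P n i"
    then have "\<forall>i<m n. \<exists>k. R (prod_encode (n, i)) k"
      using R(2) by (metis fst_conv snd_conv prod_encode_inverse)
    then obtain k where k: "\<And>i. i < m n \<Longrightarrow> R (prod_encode (n, i)) (k i)" by metis
    \<comment> \<open>The sum of the chosen witnesses serves as the common bound.\<close>
    have "k i < Suc (\<Sum>i<m n. k i)" if "i < m n" for i
      using that by (simp add: le_imp_less_Suc member_le_sum)
    with k show "\<exists>b. \<forall>i<m n. \<exists>k<b. R (prod_encode (n, i)) k" by blast
  next
    assume "\<exists>b. \<forall>i<m n. \<exists>k<b. R (prod_encode (n, i)) k"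
    then show "\<forall>i<m n. P n i"
      using R(2) by (metis fst_conv snd_conv prod_encode_inverse)
  qed
  ultimately show ?thesis by simp
qed

text \<open>Indices beyond the end of the list give \<open>0\<close>, as \<open>prod_decode 0 = (0, 0)\<close>.\<close>

definition list_nth :: "nat \<Rightarrow> nat \<Rightarrow> nat" where
  "list_nth l i = pfst (rec_nat l (\<lambda>_ h. psnd (h - 1)) i - 1)"

lemma list_nth_encode: "list_nth (list_encode xs) i = (if i < length xs then xs ! i else 0)"
proof -
  have zero: "prod_decode 0 = (0, 0)"
    by (simp add: prod_decode_def prod_decode_aux.simps)
  \<comment> \<open>The code of a nonempty list is one more than the code of the pair of its head
    and the code of its tail, hence the \<open>h - 1\<close>. The code \<open>0\<close> of the empty
    list is a fixed point of the recursion step.\<close>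
  have drop: "rec_nat (list_encode xs) (\<lambda>_ h. psnd (h - 1)) i = list_encode (drop i xs)"
  proof (induction i)
    case (Suc i)
    show ?case
    proof (cases "drop i xs")
      case Nil
      then have "drop (Suc i) xs = []" by simp
      with Nil Suc show ?thesis by (simp add: zero del: drop_eq_Nil)
    next
      case (Cons y ys)
      then have "drop (Suc i) xs = ys" by (metis drop_Suc list.sel(3) tl_drop)
      with Cons Suc show ?thesis by simp
    qed
  qed simp
  show ?thesis
    unfolding list_nth_def drop by (cases "drop i xs") (auto simp: zero nth_via_drop)
qed

lemma computable_in_list_nth [comp_intro]:
  "computable_in X f \<Longrightarrow> computable_in X g \<Longrightarrow> computable_in X (\<lambda>n. list_nth (f n) (g n))"
  unfolding list_nth_def by (intro comp_intro)

section \<open>Computation histories, graphs and selection functions\<close>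

lemma ex_list_nth: "\<exists>l. \<forall>i<m. list_nth l i = f i"
  by (rule exI[of _ "list_encode (map f [0..<m])"]) (simp add: list_nth_encode)

text \<open>A terminating recursion is certified by the list \<open>l\<close> of its intermediate
  values. The quantifiers that remain are one existential and one bounded universal, which preserve
  semidecidability.\<close>

lemma prec_op_eq_Some_iff:
  "prec_op f g n = Some v \<longleftrightarrow>
     (\<exists>l. f (pfst n) = Some (list_nth l 0) \<and>
        (\<forall>y<psnd n. g (prod_encode (pfst n, prod_encode (y, list_nth l y))) = Some (list_nth l (Suc y))) \<and>
        v = list_nth l (psnd n))"
proof -
  define h where "h = rec_nat (f (pfst n))
    (\<lambda>y h. Option.bind h (\<lambda>i. g (prod_encode (pfst n, prod_encode (y, i)))))"
  have h0: "h 0 = f (pfst n)"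
    and hS: "h (Suc y) = Option.bind (h y) (\<lambda>i. g (prod_encode (pfst n, prod_encode (y, i))))" for y
    by (simp_all add: h_def)
  have eq: "prec_op f g n = h (psnd n)"
    by (simp add: prec_op_def split_def h_def)
  show ?thesis
  proof
    assume "prec_op f g n = Some v"
    then have top: "h (psnd n) = Some v" by (simp add: eq)
    \<comment> \<open>Divergence propagates to all later values, so a defined last value forces all
      earlier ones to be defined.\<close>
    have def: "h y \<noteq> None" if "y \<le> psnd n" for y
      using that
    proof (induction y rule: inc_induct)
      case base
      then show ?case using top by simp
    next
      case (step y)
      then show ?case by (cases "h y") (auto simp: hS)
    qed
    obtain l where "\<forall>i<Suc (psnd n). list_nth l i = the (h i)"
      using ex_list_nth by meson
    with def have l: "h y = Some (list_nth l y)" if "y \<le> psnd n" for y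
      using that by (simp add: less_Suc_eq_le)
    have "g (prod_encode (pfst n, prod_encode (y, list_nth l y))) = Some (list_nth l (Suc y))"
      if "y < psnd n" for y
      using l[of y] l[of "Suc y"] that hS[of y] by simp
    with l[of 0] l[of "psnd n"] top h0
    show "\<exists>l. f (pfst n) = Some (list_nth l 0) \<and>
        (\<forall>y<psnd n. g (prod_encode (pfst n, prod_encode (y, list_nth l y))) = Some (list_nth l (Suc y))) \<and>
        v = list_nth l (psnd n)"
      by (intro exI[of _ l]) auto
  next
    assume "\<exists>l. f (pfst n) = Some (list_nth l 0) \<and>
        (\<forall>y<psnd n. g (prod_encode (pfst n, prod_encode (y, list_nth l y))) = Some (list_nth l (Suc y))) \<and>
        v = list_nth l (psnd n)"
    then obtain l where l: "f (pfst n) = Some (list_nth l 0)"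
        "\<And>y. y < psnd n \<Longrightarrow> g (prod_encode (pfst n, prod_encode (y, list_nth l y))) = Some (list_nth l (Suc y))"
        "v = list_nth l (psnd n)"
      by blast
    have "h y = Some (list_nth l y)" if "y \<le> psnd n" for y
      using that by (induction y) (use l(1,2) h0 hS in auto)
    with l(3) show "prec_op f g n = Some v" by (simp add: eq)
  qed
qed

lemma mu_op_eq_Some_iff:
  "mu_op f a = Some m \<longleftrightarrow>
     f (prod_encode (a, m)) = Some 0 \<and> (\<forall>k<m. \<exists>v. f (prod_encode (a, k)) = Some (Suc v))"
proof -
  have "(LEAST m. f (prod_encode (a, m)) = Some 0) = m"
    if "f (prod_encode (a, m)) = Some 0" "\<forall>k<m. \<exists>v. f (prod_encode (a, k)) = Some (Suc v)" for m
  proof (rule Least_equality)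
    fix k assume "f (prod_encode (a, k)) = Some 0"
    then show "m \<le> k" using that(2) by (metis linorder_not_le nat.distinct(1) option.inject)
  qed (use that in auto)
  then show ?thesis by (auto simp: mu_op_def)
qed

text \<open>A form of Kleene's normal form theorem, obtained by induction over the constructors
  instead of coding programs.\<close>

lemma semidecidable_in_graph:
  assumes "partrec_in X f"
  shows "semidecidable_in X (\<lambda>w. f (pfst w) = Some (psnd w))"
  using assms
proof induction
  case (pair f g)
  have "semidecidable_in X (\<lambda>w. \<exists>a. \<exists>b. f (pfst w) = Some a \<and> g (pfst w) = Some b \<and> psnd w = prod_encode (a, b))"
    by (intro comp_intro semidecidable_in_comp2[OF pair.IH(1)] semidecidable_in_comp2[OF pair.IH(2)]
        semidecidable_in_decidable)
  moreover have "pair_op f g n = Some m \<longleftrightarrow> (\<exists>a. \<exists>b. f n = Some a \<and> g n = Some b \<and> m = prod_encode (a, b))" for n m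
    by (auto simp: pair_op_def bind_eq_Some_conv)
  ultimately show ?case by simp
next
  case (comp f g)
  have "semidecidable_in X (\<lambda>w. \<exists>a. g (pfst w) = Some a \<and> f a = Some (psnd w))"
    by (intro comp_intro semidecidable_in_comp2[OF comp.IH(1)] semidecidable_in_comp2[OF comp.IH(2)])
  moreover have "(f \<circ>\<^sub>m g) n = Some m \<longleftrightarrow> (\<exists>a. g n = Some a \<and> f a = Some m)" for n m
    by (auto simp: map_comp_Some_iff)
  ultimately show ?case by simp
next
  case (prec f g)
  show ?case
    unfolding prec_op_eq_Some_iff
    by (intro comp_intro semidecidable_in_comp2[OF prec.IH(1)] semidecidable_in_comp2[OF prec.IH(2)]
        semidecidable_in_decidable)
next
  case (mu f)
  show ?case
    unfolding mu_op_eq_Some_iff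
    by (intro comp_intro semidecidable_in_comp2[OF mu.IH])
qed (simp_all, (intro comp_intro semidecidable_in_decidable)+)

text \<open>Search for the least code of a pair of a value and its certificate, and return the
  value. The norm algorithm and the algorithm for the identity map both arise from this selection
  principle.\<close>

lemma semidecidable_in_uniformize:
  assumes "semidecidable_in X (\<lambda>w. P (pfst w) (psnd w))"
  obtains \<phi> where "partrec_in X \<phi>" "\<And>n m. \<phi> n = Some m \<Longrightarrow> P n m"
    "\<And>n. \<exists>m. P n m \<Longrightarrow> \<exists>m. \<phi> n = Some m"
proof -
  obtain R where R: "decidable_in X (\<lambda>w. R (pfst w) (psnd w))"
      "\<And>n. P (pfst n) (psnd n) \<longleftrightarrow> (\<exists>m. R n m)"
    using assms(1) unfolding semidecidable_in_def by auto
  define S where "S n u = R (prod_encode (n, pfst u)) (psnd u)" for n u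
  have P: "P n m \<longleftrightarrow> (\<exists>k. S n (prod_encode (m, k)))" for n m
    using R(2)[of "prod_encode (n, m)"] by (simp add: S_def)
  define \<phi> where "\<phi> = (\<lambda>u. Some (pfst u)) \<circ>\<^sub>m mu_op (\<lambda>w. Some (of_bool (\<not> S (pfst w) (psnd w))))"
  have "decidable_in X (\<lambda>w. \<not> S (pfst w) (psnd w))"
    unfolding S_def by (intro comp_intro decidable_in_comp2[OF R(1)])
  then have "partrec_in X \<phi>"
    unfolding \<phi>_def decidable_in_def computable_in_def by (intro partrec_in.intros)
  moreover have \<phi>: "\<phi> n = (if \<exists>u. S n u then Some (pfst (LEAST u. S n u)) else None)" for n
    by (simp add: \<phi>_def map_comp_def mu_op_decidable)
  moreover have "P n m" if "\<phi> n = Some m" for n m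
  proof -
    have "S n (LEAST u. S n u)" "m = pfst (LEAST u. S n u)"
      using that by (auto simp: \<phi> split: if_splits intro: LeastI_ex)
    then show ?thesis unfolding P by (metis prod.collapse prod_decode_inverse)
  qed
  moreover have "\<exists>m. \<phi> n = Some m" if "\<exists>m. P n m" for n
    using that unfolding P by (auto simp: \<phi>)
  ultimately show ?thesis using that by blast
qed

text \<open>Post's theorem: the search for a witness of either \<open>P\<close> or its negation
  always ends, and the witness found tells which side holds.\<close>

lemma decidable_in_Post:
  assumes "semidecidable_in X P" "semidecidable_in X (\<lambda>n. \<not> P n)"
  shows "decidable_in X P"
proof -
  obtain R where R: "decidable_in X (\<lambda>w. R (pfst w) (psnd w))" "\<And>n. P n \<longleftrightarrow> (\<exists>m. R n m)"
    using assms(1) unfolding semidecidable_in_def by auto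
  obtain S where S: "decidable_in X (\<lambda>w. S (pfst w) (psnd w))" "\<And>n. \<not> P n \<longleftrightarrow> (\<exists>m. S n m)"
    using assms(2) unfolding semidecidable_in_def by auto
  have ex: "\<exists>m. R n m \<or> S n m" for n
    using R(2) S(2) by blast
  have "computable_in X (\<lambda>n. LEAST m. R n m \<or> S n m)"
    by (rule computable_in_Least) (auto intro!: comp_intro R S ex)
  then have "decidable_in X (\<lambda>n. R n (LEAST m. R n m \<or> S n m))"
    by (intro decidable_in_comp2[OF R(1)] comp_intro)
  moreover have "R n (LEAST m. R n m \<or> S n m) \<longleftrightarrow> P n" for n
    using LeastI_ex[OF ex[of n]] R(2) S(2) by blast
  ultimately show ?thesis by simp
qed

text \<open>Queries to the empty oracle always return \<open>0\<close>, so they can be replaced by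
  the zero function under any oracle.\<close>

lemma partrec_imp_partrec_in: "partrec f \<Longrightarrow> partrec_in X f"
proof (induction rule: partrec_in.induct)
  case query
  then show ?case using partrec_in.zero by simp
qed (rule partrec_in.intros; assumption)+

lemma decidable_in_mono: "decidable_in {} P \<Longrightarrow> decidable_in X P"
  unfolding decidable_in_def computable_in_def by (rule partrec_imp_partrec_in)

lemma semidecidable_in_mono: "semidecidable_in {} P \<Longrightarrow> semidecidable_in X P"
  unfolding semidecidable_in_def using decidable_in_mono by blast

section \<open>Rational arithmetic and lower semicomputable reals\<close>

abbreviation rdec :: "nat \<Rightarrow> real" where "rdec n \<equiv> real_of_rat (rat_decode n)"

lemma ex_rdec: "x \<in> \<rat> \<Longrightarrow> \<exists>n. rdec n = x"
  using rat_decode_surj by (metis Rats_cases)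

lemma ex_rdec_between: "x < y \<Longrightarrow> \<exists>n. x < rdec n \<and> rdec n < y"
  using of_rat_dense rat_decode_surj by metis

text \<open>Needed to read integers off \<open>int_decode\<close>, which uses even codes for
  nonnegative and odd codes for negative integers.\<close>

lemma computable_in_div2 [comp_intro]:
  assumes "computable_in X f"
  shows "computable_in X (\<lambda>n. f n div 2)"
proof -
  have eq: "n div 2 = (LEAST k. n < 2 * Suc k)" for n :: nat
    by (rule Least_equality[symmetric]) auto
  have "computable_in X (\<lambda>n. LEAST k. n < 2 * Suc k)"
  proof (rule computable_in_Least)
    show "decidable_in X (\<lambda>w. pfst w < 2 * Suc (psnd w))" by (intro comp_intro)
    show "\<exists>m. n < 2 * Suc m" for n by (rule exI[of _ n]) simp
  qed
  then show ?thesis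
    unfolding eq by (rule computable_in_comp[OF _ assms])
qed

text \<open>The signed numerator is written as a difference of two natural numbers, since the
  computable functions only handle naturals.\<close>

lemma rdec_eq:
  "rdec n = (real (if even (pfst n) then pfst n div 2 else 0) -
       real (if even (pfst n) then 0 else Suc (pfst n div 2))) / real (Suc (psnd n))"
  by (simp add: rat_decode_def split_def int_decode_def sum_decode_def of_rat_divide of_rat_minus
      of_rat_diff of_rat_add)

text \<open>A code of the value is computed, but the value itself is typed as a real, so that it can
  stand directly in comparisons with norms and powers.\<close>

definition rat_computable_in :: "nat set \<Rightarrow> (nat \<Rightarrow> real) \<Rightarrow> bool" where
  "rat_computable_in X f \<longleftrightarrow> (\<exists>g. computable_in X g \<and> (\<forall>n. f n = rdec (g n)))"

lemma rat_computable_in_rdec [comp_intro]: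
  "computable_in X f \<Longrightarrow> rat_computable_in X (\<lambda>n. rdec (f n))"
  unfolding rat_computable_in_def by blast

lemma rat_computable_in_comp:
  "rat_computable_in X f \<Longrightarrow> computable_in X g \<Longrightarrow> rat_computable_in X (\<lambda>n. f (g n))"
  unfolding rat_computable_in_def by (metis computable_in_comp)

lemma rat_computable_inI:
  assumes "computable_in X a" "computable_in X b" "computable_in X c"
    and "\<And>n. f n = (real (a n) - real (b n)) / real (Suc (c n))"
  shows "rat_computable_in X f"
proof -
  \<comment> \<open>The two branches are the \<open>int_encode\<close> codes of a nonnegative
    integer and of a negative one.\<close>
  let ?g = "\<lambda>n. prod_encode (if b n \<le> a n then 2 * (a n - b n) else 2 * (b n - a n) - 1, c n)"
  have "computable_in X ?g" by (intro comp_intro assms)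
  moreover have "f n = rdec (?g n)" for n
    unfolding rdec_eq assms(4) by (auto simp: of_nat_diff not_le elim!: less_natE)
  ultimately show ?thesis
    unfolding rat_computable_in_def by blast
qed

lemma rat_computable_inE:
  assumes "rat_computable_in X f"
  obtains a b c where "computable_in X a" "computable_in X b" "computable_in X c"
    "\<And>n. f n = (real (a n) - real (b n)) / real (Suc (c n))"
proof -
  obtain g where g: "computable_in X g" "\<And>n. f n = rdec (g n)"
    using assms unfolding rat_computable_in_def by blast
  have "decidable_in X (\<lambda>n. 2 * (pfst (g n) div 2) = pfst (g n))"
    by (intro comp_intro g)
  moreover have "2 * (k div 2) = k \<longleftrightarrow> even k" for k :: nat by presburger
  ultimately have even: "decidable_in X (\<lambda>n. even (pfst (g n)))" by simp
  show ?thesis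
    by (rule that[of "\<lambda>n. if even (pfst (g n)) then pfst (g n) div 2 else 0"
          "\<lambda>n. if even (pfst (g n)) then 0 else Suc (pfst (g n) div 2)" "\<lambda>n. psnd (g n)"])
      (use g(2) rdec_eq in \<open>auto intro!: comp_intro even g(1)\<close>)
qed

lemma rat_computable_in_fract [comp_intro]:
  "computable_in X f \<Longrightarrow> computable_in X g \<Longrightarrow> rat_computable_in X (\<lambda>n. real (f n) / real (Suc (g n)))"
  by (rule rat_computable_inI[of _ f "\<lambda>_. 0" g]) (auto intro: comp_intro)

lemma rat_computable_in_const:
  assumes "x \<in> \<rat>"
  shows "rat_computable_in X (\<lambda>n. x)"
  using ex_rdec[OF assms] rat_computable_in_rdec[OF computable_in_const] by metis

lemmas rat_computable_in_numerals [comp_intro] =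
  rat_computable_in_const[OF Rats_0] rat_computable_in_const[OF Rats_1]
  rat_computable_in_const[OF Rats_number_of]

lemma rat_computable_in_half_power [comp_intro]:
  assumes "computable_in X f"
  shows "rat_computable_in X (\<lambda>n. (1 / 2) ^ f n)"
  by (rule rat_computable_inI[of _ "\<lambda>_. 1" "\<lambda>_. 0" "\<lambda>n. 2 ^ f n - 1"])
    (auto intro!: comp_intro assms simp: power_divide of_nat_diff)

lemma rat_computable_in_uminus [comp_intro]:
  assumes "rat_computable_in X f"
  shows "rat_computable_in X (\<lambda>n. - f n)"
proof -
  obtain a b c where f: "computable_in X a" "computable_in X b" "computable_in X c"
      "\<And>n. f n = (real (a n) - real (b n)) / real (Suc (c n))"
    using rat_computable_inE[OF assms] by metis
  show ?thesis
    by (rule rat_computable_inI[OF f(2,1,3)]) (simp add: f(4) minus_divide_left)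
qed

lemma rat_computable_in_add [comp_intro]:
  assumes "rat_computable_in X f" "rat_computable_in X g"
  shows "rat_computable_in X (\<lambda>n. f n + g n)"
proof -
  obtain a b c where f: "computable_in X a" "computable_in X b" "computable_in X c"
      "\<And>n. f n = (real (a n) - real (b n)) / real (Suc (c n))"
    using rat_computable_inE[OF assms(1)] by metis
  obtain u v w where g: "computable_in X u" "computable_in X v" "computable_in X w"
      "\<And>n. g n = (real (u n) - real (v n)) / real (Suc (w n))"
    using rat_computable_inE[OF assms(2)] by metis
  show ?thesis
  proof (rule rat_computable_inI)
    \<comment> \<open>Denominators are stored diminished by one, so \<open>c * w + c + w\<close>
      represents the product of the denominators.\<close>
    show "computable_in X (\<lambda>n. a n * Suc (w n) + u n * Suc (c n))"
      "computable_in X (\<lambda>n. b n * Suc (w n) + v n * Suc (c n))"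
      "computable_in X (\<lambda>n. c n * w n + c n + w n)"
      by (intro comp_intro f g)+
    show "f n + g n = (real (a n * Suc (w n) + u n * Suc (c n)) -
       real (b n * Suc (w n) + v n * Suc (c n))) / real (Suc (c n * w n + c n + w n))" for n
    proof -
      have "real (Suc (c n * w n + c n + w n)) = real (Suc (c n)) * real (Suc (w n))"
        by (simp add: algebra_simps)
      then show ?thesis
        unfolding f(4) g(4) by (simp add: add_frac_eq del: of_nat_Suc) (simp add: algebra_simps)
    qed
  qed
qed

lemma rat_computable_in_diff [comp_intro]:
  assumes "rat_computable_in X f" "rat_computable_in X g"
  shows "rat_computable_in X (\<lambda>n. f n - g n)"
  using rat_computable_in_add[OF assms(1) rat_computable_in_uminus[OF assms(2)]] by simp

lemma rat_computable_in_mult [comp_intro]: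
  assumes "rat_computable_in X f" "rat_computable_in X g"
  shows "rat_computable_in X (\<lambda>n. f n * g n)"
proof -
  obtain a b c where f: "computable_in X a" "computable_in X b" "computable_in X c"
      "\<And>n. f n = (real (a n) - real (b n)) / real (Suc (c n))"
    using rat_computable_inE[OF assms(1)] by metis
  obtain u v w where g: "computable_in X u" "computable_in X v" "computable_in X w"
      "\<And>n. g n = (real (u n) - real (v n)) / real (Suc (w n))"
    using rat_computable_inE[OF assms(2)] by metis
  show ?thesis
  proof (rule rat_computable_inI)
    show "computable_in X (\<lambda>n. a n * u n + b n * v n)"
      "computable_in X (\<lambda>n. a n * v n + b n * u n)"
      "computable_in X (\<lambda>n. c n * w n + c n + w n)"
      by (intro comp_intro f g)+
    show "f n * g n = (real (a n * u n + b n * v n) - real (a n * v n + b n * u n)) /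
        real (Suc (c n * w n + c n + w n))" for n
    proof -
      have "real (Suc (c n * w n + c n + w n)) = real (Suc (c n)) * real (Suc (w n))"
        by (simp add: algebra_simps)
      then show ?thesis
        unfolding f(4) g(4) by (simp add: algebra_simps del: of_nat_Suc)
    qed
  qed
qed

lemma decidable_in_real_less [comp_intro]:
  assumes "rat_computable_in X f" "rat_computable_in X g"
  shows "decidable_in X (\<lambda>n. f n < g n)"
proof -
  obtain a b c where h: "computable_in X a" "computable_in X b" "computable_in X c"
      "\<And>n. g n - f n = (real (a n) - real (b n)) / real (Suc (c n))"
    using rat_computable_inE[OF rat_computable_in_diff[OF assms(2,1)]] by metis
  have "f n < g n \<longleftrightarrow> b n < a n" for n
  proof -
    have "f n < g n \<longleftrightarrow> 0 < g n - f n" by simp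
    also have "\<dots> \<longleftrightarrow> b n < a n" unfolding h(4) by (simp add: zero_less_divide_iff)
    finally show ?thesis .
  qed
  then show ?thesis by (simp add: comp_intro h)
qed

lemma decidable_in_real_le [comp_intro]:
  assumes "rat_computable_in X f" "rat_computable_in X g"
  shows "decidable_in X (\<lambda>n. f n \<le> g n)"
  using decidable_in_not[OF decidable_in_real_less[OF assms(2,1)]] by (simp add: not_less)

lemma decidable_in_real_eq [comp_intro]:
  fixes f g :: "nat \<Rightarrow> real"
  assumes "rat_computable_in X f" "rat_computable_in X g"
  shows "decidable_in X (\<lambda>n. f n = g n)"
  using decidable_in_conj[OF decidable_in_real_le[OF assms] decidable_in_real_le[OF assms(2,1)]]
  by (simp add: eq_iff)

lemma rat_computable_in_if [comp_intro]:
  assumes "decidable_in X P" "rat_computable_in X f" "rat_computable_in X g"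
  shows "rat_computable_in X (\<lambda>n. if P n then f n else g n)"
proof -
  obtain u v where "computable_in X u" "\<And>n. f n = rdec (u n)" "computable_in X v" "\<And>n. g n = rdec (v n)"
    using assms(2,3) unfolding rat_computable_in_def by blast
  then show ?thesis
    unfolding rat_computable_in_def
    by (intro exI[of _ "\<lambda>n. if P n then u n else v n"]) (simp add: comp_intro assms(1))
qed

text \<open>The recursion is carried out on codes and decoded only at the end. Finite sums and
  powers are the two instances.\<close>

lemma rat_computable_in_rec_nat:
  assumes op: "rat_computable_in X (\<lambda>w. op (rdec (pfst w)) (rdec (psnd w)))" and "x \<in> \<rat>"
    and f: "rat_computable_in X (\<lambda>w. f (pfst w) (psnd w))" and m: "computable_in X m"
  shows "rat_computable_in X (\<lambda>n. rec_nat x (\<lambda>i h. op h (f n i)) (m n))"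
proof -
  obtain g where g: "computable_in X g" "\<And>w. op (rdec (pfst w)) (rdec (psnd w)) = rdec (g w)"
    using op unfolding rat_computable_in_def by blast
  obtain F where F: "computable_in X F" "\<And>w. f (pfst w) (psnd w) = rdec (F w)"
    using f unfolding rat_computable_in_def by blast
  obtain c where c: "rdec c = x" using ex_rdec[OF assms(2)] by blast
  have "computable_in X (\<lambda>n. rec_nat c (\<lambda>i h. g (prod_encode (h, F (prod_encode (n, i))))) (m n))"
    by (intro comp_intro computable_in_comp[OF g(1)] computable_in_comp[OF F(1)] m)
  moreover have "rec_nat x (\<lambda>i h. op h (f n i)) k =
      rdec (rec_nat c (\<lambda>i h. g (prod_encode (h, F (prod_encode (n, i))))) k)" for n k
    using F(2)[of "prod_encode (n, _)"] g(2)[of "prod_encode (_, _)"]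
    by (induction k) (simp_all add: c)
  ultimately show ?thesis
    unfolding rat_computable_in_def by blast
qed

lemma rat_computable_in_sum [comp_intro]:
  assumes "rat_computable_in X (\<lambda>w. f (pfst w) (psnd w))" "computable_in X m"
  shows "rat_computable_in X (\<lambda>n. \<Sum>i<m n. f n i)"
proof -
  have eq: "(\<Sum>i<k. f n i) = rec_nat 0 (\<lambda>i h. h + f n i) k" for n k
    by (induction k) auto
  show ?thesis
    unfolding eq by (rule rat_computable_in_rec_nat) (auto intro!: comp_intro assms)
qed

lemma rat_computable_in_power [comp_intro]:
  assumes "rat_computable_in X f" "computable_in X m"
  shows "rat_computable_in X (\<lambda>n. f n ^ m n)"
proof -
  have eq: "f n ^ k = rec_nat 1 (\<lambda>i h. h * f n) k" for n k
    by (induction k) auto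
  show ?thesis
    unfolding eq
    by (rule rat_computable_in_rec_nat)
      (auto intro!: comp_intro assms rat_computable_in_comp[OF assms(1)])
qed

section \<open>Families of reals given by their rational lower cuts\<close>

definition lower_semicomputable_in :: "nat set \<Rightarrow> (nat \<Rightarrow> real) \<Rightarrow> bool" where
  "lower_semicomputable_in X f \<longleftrightarrow> semidecidable_in X (\<lambda>w. rdec (psnd w) < f (pfst w))"

lemma lower_semicomputable_in_comp:
  assumes "lower_semicomputable_in X f" "computable_in X g"
  shows "lower_semicomputable_in X (\<lambda>n. f (g n))"
  unfolding lower_semicomputable_in_def
  by (rule semidecidable_in_comp2[where P = "\<lambda>n q. rdec q < f n",
        OF assms(1)[unfolded lower_semicomputable_in_def]])
    (intro comp_intro computable_in_comp[OF assms(2)])+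

lemma lower_semicomputable_in_comp2:
  assumes "lower_semicomputable_in X (\<lambda>w. h (pfst w) (psnd w))" "computable_in X f" "computable_in X g"
  shows "lower_semicomputable_in X (\<lambda>n. h (f n) (g n))"
  using lower_semicomputable_in_comp[OF assms(1) computable_in_pair[OF assms(2,3)]] by simp

lemma lower_semicomputable_in_rat:
  assumes "rat_computable_in X f"
  shows "lower_semicomputable_in X f"
  unfolding lower_semicomputable_in_def
  by (intro semidecidable_in_decidable comp_intro rat_computable_in_comp[OF assms])

lemma semidecidable_in_rat_less:
  assumes "rat_computable_in X g" "lower_semicomputable_in X f"
  shows "semidecidable_in X (\<lambda>n. g n < f n)"
proof -
  obtain c where c: "computable_in X c" "\<And>n. g n = rdec (c n)"
    using assms(1) unfolding rat_computable_in_def by blast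
  show ?thesis
    unfolding c(2) using assms(2) unfolding lower_semicomputable_in_def
    by (rule semidecidable_in_comp2[where P = "\<lambda>n q. rdec q < f n"]) (intro comp_intro c)+
qed

text \<open>A number lies below a sum as soon as rational lower bounds of the terms, coded in one
  list, already add up to more.\<close>

lemma lower_semicomputable_in_sum [comp_intro]:
  assumes f: "lower_semicomputable_in X (\<lambda>w. f (pfst w) (psnd w))" and m: "computable_in X m"
  shows "lower_semicomputable_in X (\<lambda>n. \<Sum>i<m n. f n i)"
proof -
  have *: "x < (\<Sum>i<k. f n i) \<longleftrightarrow>
      (\<exists>l. (\<forall>i<k. rdec (list_nth l i) < f n i) \<and> x < (\<Sum>i<k. rdec (list_nth l i))) \<or>
      k = 0 \<and> x < 0" for x n k
  proof (cases "k = 0")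
    case False
    show ?thesis
    proof
      assume x: "x < (\<Sum>i<k. f n i)"
      \<comment> \<open>The gap is spread evenly over the \<open>k\<close> terms, so lower bounds
        within \<open>d\<close> of the terms still add up to more than \<open>x\<close>.\<close>
      define d where "d = ((\<Sum>i<k. f n i) - x) / k"
      have "d > 0" using x False by (simp add: d_def)
      then have "\<exists>c. f n i - d < rdec c \<and> rdec c < f n i" for i
        by (intro ex_rdec_between) simp
      then obtain c where c: "\<And>i. f n i - d < rdec (c i)" "\<And>i. rdec (c i) < f n i"
        by metis
      obtain l where l: "\<forall>i<k. list_nth l i = c i" using ex_list_nth by blast
      have "x = (\<Sum>i<k. f n i - d)"
        using False by (simp add: sum_subtractf d_def)
      also have "\<dots> < (\<Sum>i<k. rdec (c i))"
        using False c(1) by (intro sum_strict_mono) auto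
      also have "\<dots> = (\<Sum>i<k. rdec (list_nth l i))"
        using l by simp
      finally have "x < (\<Sum>i<k. rdec (list_nth l i))" .
      moreover have "\<forall>i<k. rdec (list_nth l i) < f n i"
        using c(2) l by simp
      ultimately show "(\<exists>l. (\<forall>i<k. rdec (list_nth l i) < f n i) \<and> x < (\<Sum>i<k. rdec (list_nth l i)))
          \<or> k = 0 \<and> x < 0"
        by blast
    next
      assume "(\<exists>l. (\<forall>i<k. rdec (list_nth l i) < f n i) \<and> x < (\<Sum>i<k. rdec (list_nth l i)))
          \<or> k = 0 \<and> x < 0"
      then obtain l where l: "\<forall>i<k. rdec (list_nth l i) < f n i" "x < (\<Sum>i<k. rdec (list_nth l i))"
        using False by auto
      have "(\<Sum>i<k. rdec (list_nth l i)) \<le> (\<Sum>i<k. f n i)"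
        using l(1) by (intro sum_mono) (auto intro: less_imp_le)
      with l(2) show "x < (\<Sum>i<k. f n i)" by simp
    qed
  qed auto
  show ?thesis
    unfolding lower_semicomputable_in_def *
    by (intro comp_intro semidecidable_in_rat_less lower_semicomputable_in_comp2[OF f]
        computable_in_comp[OF m] lower_semicomputable_in_rat semidecidable_in_decidable)
qed

lemma lower_semicomputable_in_add [comp_intro]:
  assumes "lower_semicomputable_in X f" "lower_semicomputable_in X g"
  shows "lower_semicomputable_in X (\<lambda>n. f n + g n)"
proof -
  have *: "x < f n + g n \<longleftrightarrow> (\<exists>a. rdec a < f n \<and> x - rdec a < g n)" for x n
  proof
    assume "x < f n + g n"
    then show "\<exists>a. rdec a < f n \<and> x - rdec a < g n"
      using ex_rdec_between[of "x - g n" "f n"] by (auto simp: algebra_simps)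
  qed auto
  show ?thesis
    unfolding lower_semicomputable_in_def *
    by (intro comp_intro semidecidable_in_rat_less lower_semicomputable_in_comp[OF assms(1)]
        lower_semicomputable_in_comp[OF assms(2)])
qed

text \<open>A strict comparison is recognized from below on the larger side and from above on the
  smaller side. Upper cuts are expressed as lower cuts of the negated family, which is why the
  closure rules come with \<open>uminus\<close> variants.\<close>

lemma semidecidable_in_real_less:
  assumes "lower_semicomputable_in X (\<lambda>n. - f n)" "lower_semicomputable_in X g"
  shows "semidecidable_in X (\<lambda>n. f n < g n)"
proof -
  have "semidecidable_in X (\<lambda>n. 0 < g n + - f n)"
    by (intro semidecidable_in_rat_less comp_intro assms)
  then show ?thesis by simp
qed

lemma lower_semicomputable_in_uminus_add [comp_intro]:
  assumes "lower_semicomputable_in X (\<lambda>n. - f n)" "lower_semicomputable_in X (\<lambda>n. - g n)"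
  shows "lower_semicomputable_in X (\<lambda>n. - (f n + g n))"
  using lower_semicomputable_in_add[OF assms] by simp

lemma lower_semicomputable_in_uminus_sum [comp_intro]:
  assumes "lower_semicomputable_in X (\<lambda>w. - f (pfst w) (psnd w))" "computable_in X m"
  shows "lower_semicomputable_in X (\<lambda>n. - (\<Sum>i<m n. f n i))"
  using lower_semicomputable_in_sum[OF assms] by (simp add: sum_negf)

text \<open>A rational is strictly on one side of \<open>x\<close> exactly when some approximation
  lies on that side by more than its own error bound.\<close>

lemma computable_real_cuts:
  assumes "computable_real x"
  shows "semidecidable_in X (\<lambda>w. rdec w < x)" "semidecidable_in X (\<lambda>w. x < rdec w)"
proof -
  obtain \<phi> where \<phi>: "partrec \<phi>" "\<forall>k. \<exists>m. \<phi> k = Some m \<and> \<bar>rdec m - x\<bar> < 1 / 2 ^ k"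
    using assms unfolding computable_real_def by blast
  define g where "g k = the (\<phi> k)" for k
  have g: "\<phi> k = Some (g k)" "\<bar>rdec (g k) - x\<bar> < (1 / 2) ^ k" for k
    using \<phi>(2)[rule_format, of k] by (auto simp: g_def power_one_over)
  then have "\<phi> = (\<lambda>k. Some (g k))" by auto
  with \<phi>(1) have "computable_in {} g" by (simp add: computable_in_def)
  then have comp: "computable_in X g"
    unfolding computable_in_def by (rule partrec_imp_partrec_in)
  \<comment> \<open>One error bound is lost in passing from \<open>x\<close> to its approximation, a
    second one is the required margin.\<close>
  have ex: "\<exists>k. 2 * (1 / 2) ^ k < d" if "d > 0" for d :: real
  proof -
    have "\<exists>k. (1 / 2) ^ k < d / 2"
      by (rule real_arch_pow_inv) (use that in auto)
    then obtain k where "(1 / 2) ^ k < d / 2" ..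
    then show ?thesis by (intro exI[of _ k]) linarith
  qed
  have "rdec w < x \<longleftrightarrow> (\<exists>k. rdec w + (1 / 2) ^ k < rdec (g k))" for w
  proof
    assume "rdec w < x"
    then obtain k where "2 * (1 / 2) ^ k < x - rdec w" using ex[of "x - rdec w"] by auto
    then show "\<exists>k. rdec w + (1 / 2) ^ k < rdec (g k)"
      using g(2)[of k] by (intro exI[of _ k]) linarith
  next
    assume "\<exists>k. rdec w + (1 / 2) ^ k < rdec (g k)"
    then obtain k where "rdec w + (1 / 2) ^ k < rdec (g k)" ..
    then show "rdec w < x" using g(2)[of k] by linarith
  qed
  moreover have "semidecidable_in X (\<lambda>w. \<exists>k. rdec w + (1 / 2) ^ k < rdec (g k))"
    by (intro comp_intro semidecidable_in_decidable computable_in_comp[OF comp])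
  ultimately show "semidecidable_in X (\<lambda>w. rdec w < x)" by simp
  have "x < rdec w \<longleftrightarrow> (\<exists>k. rdec (g k) + (1 / 2) ^ k < rdec w)" for w
  proof
    assume "x < rdec w"
    then obtain k where "2 * (1 / 2) ^ k < rdec w - x" using ex[of "rdec w - x"] by auto
    then show "\<exists>k. rdec (g k) + (1 / 2) ^ k < rdec w"
      using g(2)[of k] by (intro exI[of _ k]) linarith
  next
    assume "\<exists>k. rdec (g k) + (1 / 2) ^ k < rdec w"
    then obtain k where "rdec (g k) + (1 / 2) ^ k < rdec w" ..
    then show "x < rdec w" using g(2)[of k] by linarith
  qed
  moreover have "semidecidable_in X (\<lambda>w. \<exists>k. rdec (g k) + (1 / 2) ^ k < rdec w)"
    by (intro comp_intro semidecidable_in_decidable computable_in_comp[OF comp])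
  ultimately show "semidecidable_in X (\<lambda>w. x < rdec w)" by simp
qed

section \<open>Cuts of powers with a real exponent\<close>

lemma ex_fract_between:
  fixes u v :: real
  assumes "0 \<le> u" "u < v"
  shows "\<exists>a b. u < real a / real (Suc b) \<and> real a / real (Suc b) < v"
proof -
  obtain r where r: "r \<in> \<rat>" "u < r" "r < v" using Rats_dense_in_real[OF assms(2)] by blast
  have "r \<ge> 0" using r(2) assms(1) by simp
  then obtain m n where mn: "n \<noteq> 0" "\<bar>r\<bar> = real m / real n"
    using Rats_abs_nat_div_natE[OF r(1)] by metis
  then show ?thesis
    using r \<open>r \<ge> 0\<close> by (intro exI[of _ m] exI[of _ "n - 1"]) simp
qed

lemma power_eq_powr_fract:
  fixes x :: real
  assumes "x > 0"
  shows "x ^ a = (x powr (real a / real (Suc b))) ^ Suc b"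
  using assms by (simp add: powr_power powr_realpow del: power_Suc of_nat_Suc)

text \<open>
  Rational exponents turn the cuts of a real power into comparisons of integer powers and the cuts
  of the exponent; \<open>exp\<close> and \<open>ln\<close> need not be computed.
\<close>

lemma less_powr_iff:
  fixes x t q :: real
  assumes "q > 0" "x \<ge> 0"
  shows "t < x powr q \<longleftrightarrow> t < 0 \<or> 0 \<le> t \<and> 0 < x \<and>
    (\<exists>a b. t ^ Suc b < x ^ a \<and> (1 \<le> x \<and> real a / real (Suc b) < q \<or> x \<le> 1 \<and> q < real a / real (Suc b)))"
    (is "_ \<longleftrightarrow> _ \<or> _ \<and> _ \<and> ?R")
proof (cases "t < 0")
  case True
  then show ?thesis by (simp add: less_le_trans[OF True])
next
  case False
  show ?thesis
  proof (cases "x = 0")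
    case False
    with assms have x: "x > 0" by simp
    have "t < x powr q \<longleftrightarrow> ?R"
    proof
      assume t: "t < x powr q"
      \<comment> \<open>By continuity the exponent can be moved to a nearby fraction. It is moved
        down if the base is at least 1 and up otherwise, so that in either case the power does not
        exceed \<open>x powr q\<close>.\<close>
      have "((\<lambda>r. x powr r) \<longlongrightarrow> x powr q) (at q)"
        using x by (intro tendsto_intros) auto
      then have "eventually (\<lambda>r. t < x powr r) (at q)"
        using t by (rule order_tendstoD)
      then obtain d where d: "d > 0" "\<And>r. r \<noteq> q \<Longrightarrow> dist r q < d \<Longrightarrow> t < x powr r"
        unfolding eventually_at by blast
      have key: "t ^ Suc b < x ^ a" if "t < x powr (real a / real (Suc b))" for a b
        using that \<open>\<not> t < 0\<close> unfolding power_eq_powr_fract[OF x, of a b]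
        by (intro power_strict_mono) auto
      show ?R
      proof (cases "1 \<le> x")
        case True
        obtain a b where "max 0 (q - d) < real a / real (Suc b)" "real a / real (Suc b) < q"
          using ex_fract_between[of "max 0 (q - d)" q] d(1) assms(1) by auto
        then show ?thesis
          using True key[of a b] d(2)[of "real a / real (Suc b)"] by (auto simp: dist_real_def)
      next
        case False
        obtain a b where "q < real a / real (Suc b)" "real a / real (Suc b) < q + d"
          using ex_fract_between[of q "q + d"] d(1) assms(1) by auto
        then show ?thesis
          using False key[of a b] d(2)[of "real a / real (Suc b)"] by (auto simp: dist_real_def)
      qed
    next
      assume ?R
      then obtain a b where ab: "t ^ Suc b < x ^ a"
          "1 \<le> x \<and> real a / real (Suc b) < q \<or> x \<le> 1 \<and> q < real a / real (Suc b)"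
        by blast
      have "t < x powr (real a / real (Suc b))"
        using ab(1) unfolding power_eq_powr_fract[OF x, of a b] by (rule power_less_imp_less_base) simp
      also have "\<dots> \<le> x powr q"
        using ab(2) x by (auto intro: powr_mono powr_mono')
      finally show "t < x powr q" .
    qed
    with x \<open>\<not> t < 0\<close> show ?thesis by auto
  qed (use False in auto)
qed

text \<open>Upper cuts work like lower cuts with the two directions of moving the exponent
  exchanged; base zero is treated separately.\<close>

lemma powr_less_iff:
  fixes x t q :: real
  assumes "q > 0" "x \<ge> 0"
  shows "x powr q < t \<longleftrightarrow> 0 < t \<and> (x = 0 \<or> 0 < x \<and>
    (\<exists>a b. x ^ a < t ^ Suc b \<and> (1 \<le> x \<and> q < real a / real (Suc b) \<or> x \<le> 1 \<and> real a / real (Suc b) < q)))"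
    (is "_ \<longleftrightarrow> _ \<and> (_ \<or> _ \<and> ?R)")
proof (cases "0 < t")
  case False
  then show ?thesis by (simp add: not_less order_trans[OF _ powr_ge_zero])
next
  case True
  show ?thesis
  proof (cases "x = 0")
    case False
    with assms have x: "x > 0" by simp
    have "x powr q < t \<longleftrightarrow> ?R"
    proof
      assume t: "x powr q < t"
      have "((\<lambda>r. x powr r) \<longlongrightarrow> x powr q) (at q)"
        using x by (intro tendsto_intros) auto
      then have "eventually (\<lambda>r. x powr r < t) (at q)"
        using t by (rule order_tendstoD)
      then obtain d where d: "d > 0" "\<And>r. r \<noteq> q \<Longrightarrow> dist r q < d \<Longrightarrow> x powr r < t"
        unfolding eventually_at by blast
      have key: "x ^ a < t ^ Suc b" if "x powr (real a / real (Suc b)) < t" for a b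
        using that unfolding power_eq_powr_fract[OF x, of a b]
        by (intro power_strict_mono) auto
      show ?R
      proof (cases "1 \<le> x")
        case False
        obtain a b where "max 0 (q - d) < real a / real (Suc b)" "real a / real (Suc b) < q"
          using ex_fract_between[of "max 0 (q - d)" q] d(1) assms(1) by auto
        then show ?thesis
          using False key[of a b] d(2)[of "real a / real (Suc b)"] by (auto simp: dist_real_def)
      next
        case True
        obtain a b where "q < real a / real (Suc b)" "real a / real (Suc b) < q + d"
          using ex_fract_between[of q "q + d"] d(1) assms(1) by auto
        then show ?thesis
          using True key[of a b] d(2)[of "real a / real (Suc b)"] by (auto simp: dist_real_def)
      qed
    next
      assume ?R
      then obtain a b where ab: "x ^ a < t ^ Suc b"
          "1 \<le> x \<and> q < real a / real (Suc b) \<or> x \<le> 1 \<and> real a / real (Suc b) < q"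
        by blast
      have "x powr q \<le> x powr (real a / real (Suc b))"
        using ab(2) x by (auto intro: powr_mono powr_mono')
      also have "\<dots> < t"
        using ab(1) True unfolding power_eq_powr_fract[OF x, of a b]
        by (intro power_less_imp_less_base[of _ "Suc b" t]) auto
      finally show "x powr q < t" .
    qed
    with x True show ?thesis by auto
  qed (use True in auto)
qed

text \<open>Computability is asked of \<open>2 * q\<close> because the lemma is used with
  \<open>q = p / 2\<close>: only squared moduli of rational points are rational.\<close>

lemma lower_semicomputable_in_powr:
  assumes q: "computable_real (2 * q)" "q > 0" and f: "rat_computable_in X f" "\<And>n. f n \<ge> 0"
  shows "lower_semicomputable_in X (\<lambda>n. f n powr q)" (is ?L)
    and "lower_semicomputable_in X (\<lambda>n. - (f n powr q))" (is ?U)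
proof -
  have eq: "real a / real (Suc b) < q \<longleftrightarrow> real (2 * a) / real (Suc b) < 2 * q"
    "q < real a / real (Suc b) \<longleftrightarrow> 2 * q < real (2 * a) / real (Suc b)" for a b
    by auto
  have less: "semidecidable_in X (\<lambda>n. h n < 2 * q)" "semidecidable_in X (\<lambda>n. 2 * q < h n)"
    if h: "rat_computable_in X h" for h
  proof -
    obtain c where c: "computable_in X c" "\<And>n. h n = rdec (c n)"
      using h unfolding rat_computable_in_def by blast
    show "semidecidable_in X (\<lambda>n. h n < 2 * q)" "semidecidable_in X (\<lambda>n. 2 * q < h n)"
      unfolding c(2)
      by (rule semidecidable_in_comp[OF computable_real_cuts(1)[OF q(1)] c(1)],
          rule semidecidable_in_comp[OF computable_real_cuts(2)[OF q(1)] c(1)])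
  qed
  show ?L
    unfolding lower_semicomputable_in_def less_powr_iff[OF q(2) f(2)] eq
    by (intro comp_intro less rat_computable_in_comp[OF f(1)] semidecidable_in_decidable)
  have neg: "x < - (y powr q) \<longleftrightarrow> y powr q < - x" for x y :: real by auto
  show ?U
    unfolding lower_semicomputable_in_def neg powr_less_iff[OF q(2) f(2)] eq
    by (intro comp_intro less rat_computable_in_comp[OF f(1)] semidecidable_in_decidable)
qed

section \<open>Geometry of \<open>\<ell>\<^sup>p\<close>\<close>

text \<open>For positive arguments this is convexity of the power. If one argument is zero, it
  reduces to \<open>v powr p \<le> v\<close> for \<open>v\<close> between 0 and 1.\<close>

lemma powr_convex_nonneg:
  fixes p u x y :: real
  assumes "p \<ge> 1" "0 \<le> u" "u \<le> 1" "0 \<le> x" "0 \<le> y"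
  shows "(u * x + (1 - u) * y) powr p \<le> u * x powr p + (1 - u) * y powr p"
proof -
  have scale: "(v * z) powr p \<le> v * z powr p" if "0 \<le> v" "v \<le> 1" "0 \<le> z" for v z :: real
  proof -
    have "v powr p \<le> v powr 1"
      using that assms(1) by (intro powr_mono') auto
    then show ?thesis
      using that by (simp add: powr_mult mult_right_mono)
  qed
  consider "x = 0" | "y = 0" | "x > 0" "y > 0" using assms by fastforce
  then show ?thesis
  proof cases
    case 3
    then show ?thesis
      using convex_onD[OF powr_convex[OF assms(1)], of "1 - u" x y] assms by simp
  qed (use scale[of u x] scale[of "1 - u" y] assms in auto)
qed

section \<open>Norm inequalities and the Minkowski inequality\<close>

lemma lp_norm_nonneg: "0 \<le> lp_norm p a"
  by (simp add: lp_norm_def)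

lemma lp_norm_powr:
  assumes "p \<ge> 1" "a \<in> lp p"
  shows "lp_norm p a powr p = (\<Sum>n. cmod (a n) powr p)"
  using assms suminf_nonneg[of "\<lambda>n. cmod (a n) powr p"]
  by (simp add: lp_norm_def lp_def powr_powr)

lemma lp_norm_le_iff:
  assumes "p \<ge> 1" "a \<in> lp p" "r \<ge> 0"
  shows "lp_norm p a \<le> r \<longleftrightarrow> (\<Sum>n. cmod (a n) powr p) \<le> r powr p"
  unfolding lp_norm_powr[OF assms(1,2), symmetric]
  using assms lp_norm_nonneg[of p a] by (simp add: powr_mono_both powr_less_mono2 not_le flip: not_less)
    (metis linorder_not_less nle_le powr_less_mono2 powr_mono2 zero_less_one order_less_le_trans)

lemma lp_norm_less_iff:
  assumes "p \<ge> 1" "a \<in> lp p" "r \<ge> 0"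
  shows "lp_norm p a < r \<longleftrightarrow> (\<Sum>n. cmod (a n) powr p) < r powr p"
  unfolding lp_norm_powr[OF assms(1,2), symmetric]
  using assms lp_norm_nonneg[of p a]
  by (metis linorder_not_less nle_le powr_less_mono2 powr_mono2 zero_less_one order_less_le_trans)

lemma cmod_le_lp_norm:
  assumes "p \<ge> 1" "a \<in> lp p"
  shows "cmod (a i) \<le> lp_norm p a"
proof (rule ccontr)
  assume "\<not> cmod (a i) \<le> lp_norm p a"
  then have "(\<Sum>n. cmod (a n) powr p) < cmod (a i) powr p"
    using lp_norm_less_iff[OF assms, of "cmod (a i)"] by simp
  moreover have "(\<Sum>n\<in>{i}. cmod (a n) powr p) \<le> (\<Sum>n. cmod (a n) powr p)"
    using assms(2) by (intro sum_le_suminf) (auto simp: lp_def)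
  ultimately show False by simp
qed

text \<open>Convexity with weight \<open>u = A / (A + B)\<close> at the points \<open>x / A\<close>
  and \<open>y / B\<close>. Summed over the coordinates, with \<open>A\<close> and \<open>B\<close>
  close to the norms, it yields the triangle inequality.\<close>

lemma Minkowski_powr_le:
  fixes p A B x y :: real
  assumes "p \<ge> 1" "A > 0" "B > 0" "x \<ge> 0" "y \<ge> 0"
  shows "(x + y) powr p \<le>
    (A + B) powr p * (A / (A + B) * (x powr p / A powr p) + B / (A + B) * (y powr p / B powr p))"
proof -
  define u where "u = A / (A + B)"
  have u: "0 \<le> u" "u \<le> 1" "1 - u = B / (A + B)"
    using assms by (auto simp: u_def field_simps)
  have "u * (x / A) = x / (A + B)" "(1 - u) * (y / B) = y / (A + B)"
    using assms unfolding u(3) by (simp_all add: u_def)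
  then have "x + y = (A + B) * (u * (x / A) + (1 - u) * (y / B))"
    using assms by (simp add: distrib_left)
  then have "(x + y) powr p = (A + B) powr p * (u * (x / A) + (1 - u) * (y / B)) powr p"
    using assms u by (simp add: powr_mult)
  also have "\<dots> \<le> (A + B) powr p * (u * (x / A) powr p + (1 - u) * (y / B) powr p)"
    using assms u by (intro mult_left_mono powr_convex_nonneg) auto
  finally show ?thesis
    using assms unfolding u(3) by (simp add: u_def powr_divide)
qed

lemma Minkowski_lp:
  assumes "p \<ge> 1" "f \<in> lp p" "g \<in> lp p"
  shows "f + g \<in> lp p" and "lp_norm p (f + g) \<le> lp_norm p f + lp_norm p g"
proof -
  have sf: "summable (\<lambda>n. cmod (f n) powr p)" and sg: "summable (\<lambda>n. cmod (g n) powr p)"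
    using assms by (auto simp: lp_def)
  \<comment> \<open>Bounds strictly above the norms are positive even for zero vectors; the slack is
    removed at the end.\<close>
  have *: "f + g \<in> lp p \<and> lp_norm p (f + g) \<le> A + B"
    if A: "lp_norm p f < A" and B: "lp_norm p g < B" for A B
  proof -
    have pos: "A > 0" "B > 0"
      using A B lp_norm_nonneg[of p f] lp_norm_nonneg[of p g] by auto
    define h where "h n = (A + B) powr p *
      (A / (A + B) * (cmod (f n) powr p / A powr p) + B / (A + B) * (cmod (g n) powr p / B powr p))" for n
    have le: "cmod ((f + g) n) powr p \<le> h n" for n
    proof -
      have "cmod ((f + g) n) powr p \<le> (cmod (f n) + cmod (g n)) powr p"
        using assms(1) by (intro powr_mono2) (auto simp: norm_triangle_ineq)
      also have "\<dots> \<le> h n"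
        unfolding h_def using assms(1) pos by (intro Minkowski_powr_le) auto
      finally show ?thesis .
    qed
    have sh: "summable h"
      unfolding h_def by (intro summable_mult summable_add summable_divide sf sg)
    have mem: "f + g \<in> lp p"
      unfolding lp_def mem_Collect_eq
      by (rule summable_comparison_test'[OF sh, of 0]) (use le in auto)
    have "(\<Sum>n. cmod ((f + g) n) powr p) \<le> (\<Sum>n. h n)"
      by (rule suminf_le[OF le]) (use mem sh in \<open>auto simp: lp_def\<close>)
    also have "\<dots> = (A + B) powr p * (A / (A + B) * (lp_norm p f powr p / A powr p)
        + B / (A + B) * (lp_norm p g powr p / B powr p))"
      unfolding h_def lp_norm_powr[OF assms(1,2)] lp_norm_powr[OF assms(1,3)]
      by (simp add: suminf_mult suminf_add[symmetric] suminf_divide summable_add summable_mult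
          summable_divide sf sg)
    also have "\<dots> \<le> (A + B) powr p * (A / (A + B) * 1 + B / (A + B) * 1)"
    proof (intro mult_left_mono add_mono)
      show "lp_norm p f powr p / A powr p \<le> 1"
        using A pos assms(1) lp_norm_nonneg[of p f] by (simp add: powr_mono2)
      show "lp_norm p g powr p / B powr p \<le> 1"
        using B pos assms(1) lp_norm_nonneg[of p g] by (simp add: powr_mono2)
    qed (use pos in auto)
    also have "\<dots> = (A + B) powr p"
      using pos by (simp flip: add_divide_distrib)
    finally show ?thesis
      using mem lp_norm_le_iff[OF assms(1) mem, of "A + B"] pos by simp
  qed
  show "f + g \<in> lp p"
    using *[of "lp_norm p f + 1" "lp_norm p g + 1"] by simp
  show "lp_norm p (f + g) \<le> lp_norm p f + lp_norm p g"
  proof (rule field_le_epsilon)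
    fix e :: real assume "e > 0"
    then show "lp_norm p (f + g) \<le> lp_norm p f + lp_norm p g + e"
      using *[of "lp_norm p f + e / 2" "lp_norm p g + e / 2"] by (simp add: algebra_simps)
  qed
qed

lemma lp_cscale: "f \<in> lp p \<Longrightarrow> cscale c f \<in> lp p"
  by (simp add: lp_def cscale_def norm_mult powr_mult summable_mult)

lemma lp_norm_cscale:
  assumes "p \<ge> 1" "f \<in> lp p"
  shows "lp_norm p (cscale c f) = cmod c * lp_norm p f"
proof -
  have "(\<Sum>n. cmod (cscale c f n) powr p) = cmod c powr p * (\<Sum>n. cmod (f n) powr p)"
    using assms(2) by (simp add: lp_def cscale_def norm_mult powr_mult suminf_mult)
  moreover have "0 \<le> (\<Sum>n. cmod (f n) powr p)"
    using assms(2) by (intro suminf_nonneg) (auto simp: lp_def)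
  ultimately show ?thesis
    using assms(1) by (simp add: lp_norm_def powr_mult powr_powr)
qed

lemma lp_uminus: "f \<in> lp p \<Longrightarrow> - f \<in> lp p"
  by (simp add: lp_def)

lemma lp_norm_minus_commute: "lp_norm p (f - g) = lp_norm p (g - f)"
  by (simp add: lp_norm_def norm_minus_commute)

lemma lp_diff: "p \<ge> 1 \<Longrightarrow> f \<in> lp p \<Longrightarrow> g \<in> lp p \<Longrightarrow> f - g \<in> lp p"
  using Minkowski_lp(1)[of p f "- g"] lp_uminus by simp

lemma lp_norm_triangle:
  assumes "p \<ge> 1" "f \<in> lp p" "g \<in> lp p" "h \<in> lp p"
  shows "lp_norm p (f - h) \<le> lp_norm p (f - g) + lp_norm p (g - h)"
  using Minkowski_lp(2)[of p "f - g" "g - h"] assms by (simp add: lp_diff)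

lemma lp_finite_support:
  assumes "\<And>i. i \<ge> N \<Longrightarrow> f i = 0" "p \<ge> 1"
  shows "f \<in> lp p"
  unfolding lp_def mem_Collect_eq
  by (rule summable_finite[of "{..<N}"]) (use assms in auto)

lemma std_basis_in_lp: "p \<ge> 1 \<Longrightarrow> std_basis j \<in> lp p"
  by (rule lp_finite_support[of "Suc j"]) (auto simp: std_basis_def)

lemma lp_norm_std_basis: "p \<ge> 1 \<Longrightarrow> lp_norm p (std_basis j) = 1"
proof -
  assume "p \<ge> 1"
  then have "(\<lambda>n. cmod (std_basis j n) powr p) = (\<lambda>n. if n = j then 1 else 0)"
    by (auto simp: std_basis_def)
  then show ?thesis
    using suminf_finite[of "{j}" "\<lambda>n. if n = j then 1 else 0 :: real"] by (simp add: lp_norm_def)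
qed

lemma lp_norm_eq_0: "p \<ge> 1 \<Longrightarrow> f \<in> lp p \<Longrightarrow> lp_norm p f = 0 \<Longrightarrow> f = 0"
  using cmod_le_lp_norm[of p f] by (simp add: fun_eq_iff)

lemma lp_zero: "p \<ge> 1 \<Longrightarrow> 0 \<in> lp p"
  by (rule lp_finite_support[of 0]) auto

section \<open>Parallelogram inequalities and their equality case\<close>

text \<open>Split each power as \<open>x powr q = x * x powr (q - 1)\<close>; the second factor
  grows strictly when \<open>x\<close> is replaced by \<open>u + v\<close>.\<close>

lemma powr_superadd_strict:
  fixes u v q :: real
  assumes "q > 1" "u > 0" "v > 0"
  shows "u powr q + v powr q < (u + v) powr q"
proof -
  have base: "x powr q = x * x powr (q - 1)" if "x > 0" for x
    using that by (simp add: powr_mult_base)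
  have "u * u powr (q - 1) < u * (u + v) powr (q - 1)" "v * v powr (q - 1) < v * (u + v) powr (q - 1)"
    using assms by (auto intro!: powr_less_mono2)
  moreover have "(u + v) * (u + v) powr (q - 1) = u * (u + v) powr (q - 1) + v * (u + v) powr (q - 1)"
    by (simp add: distrib_right)
  ultimately show ?thesis
    unfolding base[OF assms(2)] base[OF assms(3)] base[OF add_pos_pos[OF assms(2,3)]] by linarith
qed

lemma powr_subadd_strict:
  fixes u v q :: real
  assumes "q < 1" "u > 0" "v > 0"
  shows "(u + v) powr q < u powr q + v powr q"
proof -
  have base: "x powr q = x * x powr (q - 1)" if "x > 0" for x
    using that by (simp add: powr_mult_base)
  have "u * (u + v) powr (q - 1) < u * u powr (q - 1)" "v * (u + v) powr (q - 1) < v * v powr (q - 1)"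
    using assms by (auto intro!: powr_less_mono2_neg)
  moreover have "(u + v) * (u + v) powr (q - 1) = u * (u + v) powr (q - 1) + v * (u + v) powr (q - 1)"
    by (simp add: distrib_right)
  ultimately show ?thesis
    unfolding base[OF assms(2)] base[OF assms(3)] base[OF add_pos_pos[OF assms(2,3)]] by linarith
qed

text \<open>Squared moduli obey the parallelogram law and are rational at rational points; both the
  geometry and the algorithms rely on this rewriting.\<close>

lemma cmod_powr_half: "cmod z powr p = (cmod z ^ 2) powr (p / 2)"
proof -
  have "cmod z ^ 2 = cmod z powr 2"
    by (cases "z = 0") (simp_all add: powr_realpow)
  then show ?thesis by (simp only: powr_powr) simp
qed

lemma cmod_parallelogram: "cmod (a + b) ^ 2 + cmod (a - b) ^ 2 = 2 * (cmod a ^ 2 + cmod b ^ 2)"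
  unfolding cmod_power2 by (simp add: power2_eq_square algebra_simps)

text \<open>Convexity of the power \<open>p / 2\<close> together with the parallelogram law bounds
  the right side below by \<open>2 * (cmod a ^ 2 + cmod b ^ 2) powr (p / 2)\<close>. Superadditivity
  of that power then separates the two squares, strictly if both are positive.\<close>

lemma powr_parallelogram_gt2:
  assumes "p > 2"
  shows "2 * (cmod a powr p + cmod b powr p) \<le> cmod (a + b) powr p + cmod (a - b) powr p"
    and "a \<noteq> 0 \<Longrightarrow> b \<noteq> 0 \<Longrightarrow>
      2 * (cmod a powr p + cmod b powr p) < cmod (a + b) powr p + cmod (a - b) powr p"
proof -
  let ?u = "cmod (a + b) ^ 2" and ?v = "cmod (a - b) ^ 2" and ?q = "p / 2"
  have eq: "1 / 2 * ?u + (1 - 1 / 2) * ?v = cmod a ^ 2 + cmod b ^ 2"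
    using cmod_parallelogram[of a b] by simp
  have "(1 / 2 * ?u + (1 - 1 / 2) * ?v) powr ?q \<le> 1 / 2 * ?u powr ?q + (1 - 1 / 2) * ?v powr ?q"
    by (rule powr_convex_nonneg) (use assms in auto)
  then have mean: "2 * (cmod a ^ 2 + cmod b ^ 2) powr ?q \<le> cmod (a + b) powr p + cmod (a - b) powr p"
    unfolding eq cmod_powr_half[of _ p] by simp
  show strict: "2 * (cmod a powr p + cmod b powr p) < cmod (a + b) powr p + cmod (a - b) powr p"
    if "a \<noteq> 0" "b \<noteq> 0"
    using powr_superadd_strict[of ?q "cmod a ^ 2" "cmod b ^ 2"] that assms mean
    unfolding cmod_powr_half[of a p] cmod_powr_half[of b p] by simp
  show "2 * (cmod a powr p + cmod b powr p) \<le> cmod (a + b) powr p + cmod (a - b) powr p"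
    using strict assms by (cases "a = 0 \<or> b = 0") auto
qed

text \<open>The inequalities of the case \<open>p > 2\<close> reverse: convexity is applied to the
  inverse exponent \<open>2 / p\<close>, and the power \<open>p / 2\<close> is subadditive.\<close>

lemma powr_parallelogram_lt2:
  assumes "0 < p" "p < 2"
  shows "cmod (a + b) powr p + cmod (a - b) powr p \<le> 2 * (cmod a powr p + cmod b powr p)"
    and "a \<noteq> 0 \<Longrightarrow> b \<noteq> 0 \<Longrightarrow>
      cmod (a + b) powr p + cmod (a - b) powr p < 2 * (cmod a powr p + cmod b powr p)"
proof -
  let ?u = "cmod (a + b) powr p" and ?v = "cmod (a - b) powr p" and ?q = "p / 2"
  have sq: "(x powr p) powr (1 / ?q) = x ^ 2" if "x \<ge> 0" for x :: real
  proof -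
    have "(x powr p) powr (1 / ?q) = x powr (p * (1 / ?q))" by (rule powr_powr)
    also have "p * (1 / ?q) = 2" using assms by simp
    also have "x powr 2 = x ^ 2" using that by (cases "x = 0") simp_all
    finally show ?thesis .
  qed
  have "((?u + ?v) / 2) powr (1 / ?q) \<le> (?u powr (1 / ?q) + ?v powr (1 / ?q)) / 2"
    using powr_convex_nonneg[of "1 / ?q" "1 / 2" ?u ?v] assms by (simp add: field_simps)
  also have "\<dots> = cmod a ^ 2 + cmod b ^ 2"
    by (simp only: sq norm_ge_zero cmod_parallelogram) simp
  finally have "(((?u + ?v) / 2) powr (1 / ?q)) powr ?q \<le> (cmod a ^ 2 + cmod b ^ 2) powr ?q"
    using assms by (intro powr_mono2) auto
  then have mean: "?u + ?v \<le> 2 * (cmod a ^ 2 + cmod b ^ 2) powr ?q"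
    using assms by (simp add: powr_powr)
  show strict: "?u + ?v < 2 * (cmod a powr p + cmod b powr p)"
    if "a \<noteq> 0" "b \<noteq> 0"
    using powr_subadd_strict[of ?q "cmod a ^ 2" "cmod b ^ 2"] that assms mean
    unfolding cmod_powr_half[of a p] cmod_powr_half[of b p] by simp
  show "?u + ?v \<le> 2 * (cmod a powr p + cmod b powr p)"
    using strict assms by (cases "a = 0 \<or> b = 0") auto
qed

text \<open>The coordinatewise differences all have the same sign, so equality of the sums forces
  equality in every coordinate, which the strict inequalities exclude unless one entry is
  zero.\<close>

lemma suminf_parallelogram_eq:
  assumes p: "p \<ge> 1" "p \<noteq> 2" and fg: "f \<in> lp p" "g \<in> lp p"
    and eq: "(\<Sum>n. cmod ((f + g) n) powr p) + (\<Sum>n. cmod ((f - g) n) powr p) =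
      2 * ((\<Sum>n. cmod (f n) powr p) + (\<Sum>n. cmod (g n) powr p))"
  shows "f i = 0 \<or> g i = 0"
proof -
  let ?L = "\<lambda>n. cmod ((f + g) n) powr p + cmod ((f - g) n) powr p"
  let ?R = "\<lambda>n. 2 * (cmod (f n) powr p + cmod (g n) powr p)"
  have s: "summable (\<lambda>n. cmod (f n) powr p)" "summable (\<lambda>n. cmod (g n) powr p)"
    "summable (\<lambda>n. cmod ((f + g) n) powr p)" "summable (\<lambda>n. cmod ((f - g) n) powr p)"
    using fg Minkowski_lp(1)[OF p(1) fg] lp_diff[OF p(1) fg] unfolding lp_def by blast+
  have sL: "summable ?L" and sR: "summable ?R"
    by (intro summable_add summable_mult s)+
  have "suminf ?L = suminf ?R"
    using eq s by (simp add: suminf_add[symmetric] suminf_mult summable_add del: plus_fun_apply minus_apply)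
  then have sum0: "(\<Sum>n. ?L n - ?R n) = 0" "(\<Sum>n. ?R n - ?L n) = 0"
    using suminf_diff[OF sL sR] suminf_diff[OF sR sL] by auto
  show ?thesis
  proof (cases "p > 2")
    case True
    have "\<forall>n. ?L n - ?R n = 0"
      using suminf_eq_zero_iff[OF summable_diff[OF sL sR]] sum0 powr_parallelogram_gt2(1)[OF True]
      by simp
    then show ?thesis
      using powr_parallelogram_gt2(2)[OF True, of "f i" "g i"] by fastforce
  next
    case False
    with p have p2: "0 < p" "p < 2" by auto
    have "\<forall>n. ?R n - ?L n = 0"
      using suminf_eq_zero_iff[OF summable_diff[OF sR sL]] sum0 powr_parallelogram_lt2(1)[OF p2]
      by simp
    then show ?thesis
      using powr_parallelogram_lt2(2)[OF p2, of "f i" "g i"] by fastforce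
  qed
qed

section \<open>Surjective linear isometries and disjoint supports\<close>

lemma surj_linear_isometry_zero:
  assumes "surj_linear_isometry p T" "p \<ge> 1"
  shows "T 0 = 0"
proof -
  have "T (cscale 0 0) = cscale 0 (T 0)"
    using assms lp_zero unfolding surj_linear_isometry_def by blast
  then show ?thesis by (simp add: cscale_def zero_fun_def)
qed

lemma surj_linear_isometry_norm:
  assumes "surj_linear_isometry p T" "p \<ge> 1" "f \<in> lp p"
  shows "lp_norm p (T f) = lp_norm p f"
  using assms surj_linear_isometry_zero[OF assms(1,2)] lp_zero[OF assms(2)]
  unfolding surj_linear_isometry_def by (metis diff_zero)

lemma surj_linear_isometry_mem:
  "surj_linear_isometry p T \<Longrightarrow> f \<in> lp p \<Longrightarrow> T f \<in> lp p"
  unfolding surj_linear_isometry_def by blast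

text \<open>For disjoint vectors the \<open>p\<close>-th powers of the norms of \<open>f + g\<close>
  and \<open>f - g\<close> both split. This is the equality case of the parallelogram inequality,
  and an isometry carries it over to the images.\<close>

lemma surj_linear_isometry_disjoint:
  assumes T: "surj_linear_isometry p T" and p: "p \<ge> 1" "p \<noteq> 2"
    and fg: "f \<in> lp p" "g \<in> lp p" and disj: "\<And>i. f i = 0 \<or> g i = 0"
  shows "T f i = 0 \<or> T g i = 0"
proof (rule suminf_parallelogram_eq[OF p])
  show mem: "T f \<in> lp p" "T g \<in> lp p"
    using T fg by (auto intro: surj_linear_isometry_mem)
  have norms: "lp_norm p (T f) = lp_norm p f" "lp_norm p (T g) = lp_norm p g"
    "lp_norm p (T f + T g) = lp_norm p (f + g)" "lp_norm p (T f - T g) = lp_norm p (f - g)"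
    using surj_linear_isometry_norm[OF T p(1)] fg Minkowski_lp(1)[OF p(1) fg] T
    unfolding surj_linear_isometry_def by metis+
  have s: "summable (\<lambda>n. cmod (f n) powr p)" "summable (\<lambda>n. cmod (g n) powr p)"
    using fg by (auto simp: lp_def)
  have "cmod ((f + g) n) powr p = cmod (f n) powr p + cmod (g n) powr p"
    "cmod ((f - g) n) powr p = cmod (f n) powr p + cmod (g n) powr p" for n
    using disj[of n] p by auto
  then have "lp_norm p (f + g) powr p = lp_norm p f powr p + lp_norm p g powr p"
    "lp_norm p (f - g) powr p = lp_norm p f powr p + lp_norm p g powr p"
    using fg Minkowski_lp(1)[OF p(1) fg] lp_diff[OF p(1) fg] p suminf_add[OF s]
    by (simp_all add: lp_norm_powr del: plus_fun_apply minus_apply)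
  then show "(\<Sum>n. cmod ((T f + T g) n) powr p) + (\<Sum>n. cmod ((T f - T g) n) powr p) =
      2 * ((\<Sum>n. cmod (T f n) powr p) + (\<Sum>n. cmod (T g n) powr p))"
    using lp_norm_powr[OF p(1) mem(1)] lp_norm_powr[OF p(1) mem(2)]
      lp_norm_powr[OF p(1) Minkowski_lp(1)[OF p(1) mem]] lp_norm_powr[OF p(1) lp_diff[OF p(1) mem]]
    unfolding norms by simp
qed

text \<open>The part of the Banach-Lamperti description that is needed. Split a preimage of a basis
  vector into one nonzero coordinate \<open>f\<close> and the rest: the images are disjoint and add
  up to a basis vector, so the nonzero image \<open>T f\<close> is all of it.\<close>

lemma surj_linear_isometry_preimage_std_basis:
  assumes T: "surj_linear_isometry p T" and p: "p \<ge> 1" "p \<noteq> 2"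
  obtains j c where "cmod c = 1" "T (std_basis j) = cscale c (std_basis i)"
proof -
  have add: "T (f + g) = T f + T g" if "f \<in> lp p" "g \<in> lp p" for f g
    using T that unfolding surj_linear_isometry_def by blast
  have scale: "T (cscale c f) = cscale c (T f)" if "f \<in> lp p" for c f
    using T that unfolding surj_linear_isometry_def by blast
  obtain g where g: "g \<in> lp p" "T g = std_basis i"
    using T std_basis_in_lp[OF p(1), of i] unfolding surj_linear_isometry_def by (metis imageE)
  have "lp_norm p g = 1"
    using surj_linear_isometry_norm[OF T p(1) g(1)] g(2) lp_norm_std_basis[OF p(1)] by simp
  then have "g \<noteq> 0" using p by (auto simp: lp_norm_def)
  then obtain j where j: "g j \<noteq> 0" by (auto simp: fun_eq_iff)
  define f where "f = cscale (g j) (std_basis j)"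
  have f: "f \<in> lp p" unfolding f_def by (intro lp_cscale std_basis_in_lp p)
  have gf: "g - f \<in> lp p" by (intro lp_diff p g f)
  have "f k = 0 \<or> (g - f) k = 0" for k
    by (simp add: f_def cscale_def std_basis_def)
  then have disj: "T f k = 0 \<or> T (g - f) k = 0" for k
    by (intro surj_linear_isometry_disjoint[OF T p f gf])
  have sum: "T f k + T (g - f) k = std_basis i k" for k
    using add[OF f gf] g(2) by (simp add: fun_eq_iff)
  have "T f \<noteq> 0"
  proof
    assume "T f = 0"
    then have "lp_norm p f = 0"
      using surj_linear_isometry_norm[OF T p(1) f] p by (simp add: lp_norm_def)
    then have "f = 0" using lp_norm_eq_0[OF p(1) f] by simp
    then have "f j = 0" by simp
    then show False using j by (simp add: f_def cscale_def std_basis_def)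
  qed
  \<comment> \<open>Away from \<open>i\<close> the two images add up to zero and one of them
    vanishes, so both do.\<close>
  have off: "T f k = 0" if "k \<noteq> i" for k
    using disj[of k] sum[of k] that by (auto simp: std_basis_def)
  have "T f i \<noteq> 0"
  proof
    assume "T f i = 0"
    with off have "T f k = 0" for k by (cases "k = i") auto
    with \<open>T f \<noteq> 0\<close> show False by (auto simp: fun_eq_iff)
  qed
  with disj[of i] sum[of i] have "T f i = 1" by (auto simp: std_basis_def)
  with off have Tf: "T f = std_basis i" by (auto simp: std_basis_def fun_eq_iff)
  have "cscale (g j) (T (std_basis j)) = std_basis i"
    using Tf scale[OF std_basis_in_lp[OF p(1)]] by (simp add: f_def)
  then have Te: "T (std_basis j) = cscale (1 / g j) (std_basis i)"
    using j by (auto simp: cscale_def fun_eq_iff field_simps)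
  moreover have "cmod (1 / g j) = 1"
    using surj_linear_isometry_norm[OF T p(1) std_basis_in_lp[OF p(1)], of j]
    unfolding Te lp_norm_cscale[OF p(1) std_basis_in_lp[OF p(1)]] by (simp add: lp_norm_std_basis p)
  ultimately show ?thesis using that by blast
qed

section \<open>Rational coefficient sequences and their density\<close>

definition coef :: "nat \<Rightarrow> nat \<Rightarrow> complex" where
  "coef c j = point_decode (if j = 0 then pfst c else list_nth (psnd c) (j - 1))"

lemma point_decode_0: "point_decode 0 = 0"
proof -
  have "prod_decode 0 = (0, 0)"
    by (simp add: prod_decode_def prod_decode_aux.simps)
  then show ?thesis
    by (simp add: point_decode_def rat_decode_def int_decode_def sum_decode_def complex_eq_iff)
qed

text \<open>The coded list is padded with zeros, because \<open>list_nth\<close> returns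
  \<open>0\<close> past the end and \<open>0\<close> codes the point zero. Sums over coefficients
  may thus run to any sufficiently large bound.\<close>

lemma coef_eq: "coef c j = (if j < length (points_decode c) then points_decode c ! j else 0)"
  using list_nth_encode[of "list_decode (psnd c)" "j - 1"]
  by (cases j) (auto simp: coef_def points_decode_def split_def point_decode_0)

text \<open>Makes the code itself available as a computable bound on the number of
  coefficients.\<close>

lemma length_points_decode: "length (points_decode c) \<le> Suc c"
proof -
  have "length xs \<le> list_encode xs" for xs
  proof (induction xs)
    case (Cons x xs)
    then show ?case using le_prod_encode_2[of "list_encode xs" x] by simp
  qed simp
  from this[of "list_decode (psnd c)"] have "length (list_decode (psnd c)) \<le> psnd c" by simp
  also have "\<dots> \<le> c"
    using le_prod_encode_2[of "psnd c" "pfst c"] by simp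
  finally show ?thesis by (simp add: points_decode_def split_def)
qed

lemma coef_eq_0: "c < j \<Longrightarrow> coef c j = 0"
  using length_points_decode[of c] by (simp add: coef_eq)

lemma coef_rational: "Re (coef c j) \<in> \<rat>" "Im (coef c j) \<in> \<rat>"
  using range_point_decode unfolding coef_def by blast+

lemma ex_coef:
  assumes "\<And>j. Re (v j) \<in> \<rat> \<and> Im (v j) \<in> \<rat>" "\<And>j. j > M \<Longrightarrow> v j = 0"
  shows "\<exists>c. \<forall>j. coef c j = v j"
proof -
  have "map v [0..<Suc M] \<in> range points_decode"
    unfolding range_points_decode using assms(1) by auto
  then obtain c where c: "points_decode c = map v [0..<Suc M]" by (metis imageE)
  have "coef c j = v j" for j
    using assms(2)[of j] unfolding coef_eq c by (auto simp: less_Suc_eq_le simp del: upt_Suc)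
  then show ?thesis by blast
qed

lemma lincomb_apply: "lincomb G (points_decode c) i = (\<Sum>j\<le>c. coef c j * G j i)"
proof -
  have sum_apply: "(\<Sum>j\<in>A. h j) i = (\<Sum>j\<in>A. h j i)" for A :: "nat set" and h :: "nat \<Rightarrow> nat \<Rightarrow> complex"
    by (induction A rule: infinite_finite_induct) auto
  have "lincomb G (points_decode c) i = (\<Sum>j<length (points_decode c). coef c j * G j i)"
    unfolding lincomb_def sum_apply by (simp add: cscale_def coef_eq)
  also have "\<dots> = (\<Sum>j\<le>c. coef c j * G j i)"
    using length_points_decode[of c] by (intro sum.mono_neutral_left) (auto simp: coef_eq)
  finally show ?thesis .
qed

lemma lincomb_std_basis: "lincomb std_basis (points_decode c) = coef c"
proof
  fix i
  have "lincomb std_basis (points_decode c) i = (\<Sum>j\<le>c. if j = i then coef c j else 0)"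
    unfolding lincomb_apply by (intro sum.cong) (auto simp: std_basis_def)
  also have "\<dots> = coef c i" by (auto simp: coef_eq_0)
  finally show "lincomb std_basis (points_decode c) i = coef c i" .
qed

lemma coef_in_lp: "p \<ge> 1 \<Longrightarrow> coef c \<in> lp p"
  by (rule lp_finite_support[of "Suc c"]) (auto simp: coef_eq_0)

text \<open>Cut the sequence where its tail costs less than half of \<open>e powr p\<close>, and
  round the remaining coordinates to rational points.\<close>

lemma ex_coef_near:
  assumes p: "p \<ge> 1" and f: "f \<in> lp p" and e: "e > 0"
  shows "\<exists>c. lp_norm p (f - coef c) < e"
proof -
  have s: "summable (\<lambda>n. cmod (f n) powr p)" using f by (simp add: lp_def)
  have ep: "e powr p > 0" using e by simp
  obtain N where N: "\<And>m. m \<ge> N \<Longrightarrow> \<bar>\<Sum>i. cmod (f (i + m)) powr p\<bar> < e powr p / 2"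
    using suminf_exist_split[OF _ s, of "e powr p / 2"] ep by auto
  \<comment> \<open>Rounding \<open>N\<close> coordinates by at most \<open>d\<close> costs at most
    the other half; \<open>Suc N\<close> keeps the quotient meaningful for
    \<open>N = 0\<close>.\<close>
  define d where "d = (e powr p / (2 * real (Suc N))) powr (1 / p)"
  have d: "d > 0" "d powr p = e powr p / (2 * real (Suc N))"
    using ep p by (auto simp: d_def powr_powr simp del: of_nat_Suc)
  have "\<exists>w. Re w \<in> \<rat> \<and> Im w \<in> \<rat> \<and> cmod (z - w) < d" for z
  proof -
    obtain a where a: "a \<in> \<rat>" "Re z < a" "a < Re z + d / 2"
      using Rats_dense_in_real[of "Re z" "Re z + d / 2"] d by auto
    obtain b where b: "b \<in> \<rat>" "Im z < b" "b < Im z + d / 2"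
      using Rats_dense_in_real[of "Im z" "Im z + d / 2"] d by auto
    have "cmod (z - Complex a b) \<le> \<bar>Re (z - Complex a b)\<bar> + \<bar>Im (z - Complex a b)\<bar>"
      by (rule cmod_le)
    also have "\<dots> < d" using a b by simp
    finally show ?thesis using a b by (intro exI[of _ "Complex a b"]) simp
  qed
  then obtain w where w: "\<And>z. Re (w z) \<in> \<rat>" "\<And>z. Im (w z) \<in> \<rat>" "\<And>z. cmod (z - w z) < d"
    by metis
  have "\<exists>c. \<forall>j. coef c j = (if j < N then w (f j) else 0)"
    by (rule ex_coef[of _ N]) (use w in auto)
  then obtain c where c: "\<And>j. coef c j = (if j < N then w (f j) else 0)" by blast
  have mem: "f - coef c \<in> lp p" by (intro lp_diff p f coef_in_lp)
  then have "summable (\<lambda>n. cmod ((f - coef c) n) powr p)" by (simp add: lp_def)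
  then have "(\<Sum>n. cmod ((f - coef c) n) powr p) =
      (\<Sum>n. cmod ((f - coef c) (n + N)) powr p) + (\<Sum>n<N. cmod ((f - coef c) n) powr p)"
    by (rule suminf_split_initial_segment)
  also have "(\<Sum>n. cmod ((f - coef c) (n + N)) powr p) = (\<Sum>n. cmod (f (n + N)) powr p)"
    by (simp add: c)
  also have "\<dots> < e powr p / 2" using N[of N] by simp
  also have "(\<Sum>n<N. cmod ((f - coef c) n) powr p) \<le> (\<Sum>n<N. d powr p)"
    using w(3) p by (intro sum_mono powr_mono2) (auto simp: c intro: less_imp_le)
  also have "\<dots> \<le> real (Suc N) * d powr p" by (simp add: mult_right_mono)
  also have "\<dots> = e powr p / 2" unfolding d by (simp add: field_simps)
  finally have "(\<Sum>n. cmod ((f - coef c) n) powr p) < e powr p" by simp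
  then show ?thesis using lp_norm_less_iff[OF p mem, of e] e by auto
qed

section \<open>The generating set\<close>

definition complex_rat_computable_in :: "nat set \<Rightarrow> (nat \<Rightarrow> complex) \<Rightarrow> bool" where
  "complex_rat_computable_in X f \<longleftrightarrow>
     rat_computable_in X (\<lambda>n. Re (f n)) \<and> rat_computable_in X (\<lambda>n. Im (f n))"

lemma complex_rat_computable_in_of_real [comp_intro]:
  "rat_computable_in X f \<Longrightarrow> complex_rat_computable_in X (\<lambda>n. complex_of_real (f n))"
  by (simp add: complex_rat_computable_in_def comp_intro)

lemma complex_rat_computable_in_0_1 [comp_intro]:
  "complex_rat_computable_in X (\<lambda>n. 0)" "complex_rat_computable_in X (\<lambda>n. 1)"
  by (simp_all add: complex_rat_computable_in_def comp_intro)

lemma complex_rat_computable_in_add [comp_intro]: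
  "complex_rat_computable_in X f \<Longrightarrow> complex_rat_computable_in X g \<Longrightarrow>
     complex_rat_computable_in X (\<lambda>n. f n + g n)"
  by (simp add: complex_rat_computable_in_def comp_intro)

lemma complex_rat_computable_in_diff [comp_intro]:
  "complex_rat_computable_in X f \<Longrightarrow> complex_rat_computable_in X g \<Longrightarrow>
     complex_rat_computable_in X (\<lambda>n. f n - g n)"
  by (simp add: complex_rat_computable_in_def comp_intro)

lemma complex_rat_computable_in_mult [comp_intro]:
  "complex_rat_computable_in X f \<Longrightarrow> complex_rat_computable_in X g \<Longrightarrow>
     complex_rat_computable_in X (\<lambda>n. f n * g n)"
  by (simp add: complex_rat_computable_in_def comp_intro)

lemma complex_rat_computable_in_if [comp_intro]:
  assumes "decidable_in X P" "complex_rat_computable_in X f" "complex_rat_computable_in X g"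
  shows "complex_rat_computable_in X (\<lambda>n. if P n then f n else g n)"
  using assms unfolding complex_rat_computable_in_def if_distrib[of Re] if_distrib[of Im]
  by (intro conjI rat_computable_in_if) auto

lemma decidable_in_complex_eq [comp_intro]:
  fixes f g :: "nat \<Rightarrow> complex"
  assumes "complex_rat_computable_in X f" "complex_rat_computable_in X g"
  shows "decidable_in X (\<lambda>n. f n = g n)"
  using assms unfolding complex_rat_computable_in_def complex_eq_iff
  by (auto intro: comp_intro)

lemma complex_rat_computable_in_coef [comp_intro]:
  assumes "computable_in X f" "computable_in X g"
  shows "complex_rat_computable_in X (\<lambda>n. coef (f n) (g n))"
proof -
  have "Re (point_decode n) = rdec (pfst n)" "Im (point_decode n) = rdec (psnd n)" for n
    by (simp_all add: point_decode_def split_def)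
  then show ?thesis
    unfolding complex_rat_computable_in_def coef_def by (simp only:) (intro conjI comp_intro assms)
qed

lemma lower_semicomputable_in_cmod_powr [comp_intro]:
  assumes "computable_real p" "p \<ge> 1" "complex_rat_computable_in X f"
  shows "lower_semicomputable_in X (\<lambda>n. cmod (f n) powr p)"
    and "lower_semicomputable_in X (\<lambda>n. - (cmod (f n) powr p))"
proof -
  have "rat_computable_in X (\<lambda>n. (cmod (f n))\<^sup>2)"
    using assms(3) unfolding cmod_power2 complex_rat_computable_in_def by (intro comp_intro) auto
  then show "lower_semicomputable_in X (\<lambda>n. cmod (f n) powr p)"
    "lower_semicomputable_in X (\<lambda>n. - (cmod (f n) powr p))"
    unfolding cmod_powr_half[of _ p]
    by (intro lower_semicomputable_in_powr; use assms in simp)+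
qed

lemma lower_semicomputable_in_abs_powr [comp_intro]:
  assumes "computable_real p" "p \<ge> 1" "rat_computable_in X f"
  shows "lower_semicomputable_in X (\<lambda>n. \<bar>f n\<bar> powr p)"
    and "lower_semicomputable_in X (\<lambda>n. - (\<bar>f n\<bar> powr p))"
  using lower_semicomputable_in_cmod_powr[OF assms(1,2) complex_rat_computable_in_of_real[OF assms(3)]]
  by simp_all

lemma sum_powers_le:
  fixes x :: real
  assumes "0 \<le> x" "x \<le> 1 / 2" "finite S" "S \<subseteq> {K..}"
  shows "(\<Sum>n\<in>S. x ^ (n + 2)) \<le> x ^ (K + 1)"
proof -
  \<comment> \<open>For ratio at most 1/2 each term is bounded by a difference of consecutive
    powers, and the sum telescopes.\<close>
  have step: "x ^ (n + 2) \<le> x ^ (n + 1) - x ^ (n + 2)" for n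
    using mult_right_mono[OF assms(2), of "x ^ (n + 1)"] assms(1) by simp
  have "(\<Sum>n\<in>{K..<K + d}. x ^ (n + 2)) \<le> x ^ (K + 1) - x ^ (K + d + 1)" for d
  proof (induction d)
    case (Suc d)
    have "(\<Sum>n\<in>{K..<K + Suc d}. x ^ (n + 2)) = (\<Sum>n\<in>{K..<K + d}. x ^ (n + 2)) + x ^ (K + d + 2)"
      by simp
    also have "\<dots> \<le> x ^ (K + 1) - x ^ (K + Suc d + 1)"
      using Suc step[of "K + d"] by simp
    finally show ?case .
  qed simp
  moreover obtain d where "S \<subseteq> {K..<K + d}"
  proof
    show "S \<subseteq> {K..<K + Suc (Max S)}"
    proof
      fix n assume "n \<in> S"
      then have "K \<le> n" "n \<le> Max S" using assms(3,4) by auto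
      then show "n \<in> {K..<K + Suc (Max S)}" by simp
    qed
  qed
  moreover have "0 \<le> x ^ (K + d + 1)" using assms(1) by simp
  ultimately show ?thesis
    using sum_mono2[of "{K..<K + d}" S "\<lambda>n. x ^ (n + 2)"] assms(1)
    by (smt (verit) finite_atLeastLessThan zero_le_power)
qed

section \<open>Codes of rational balls\<close>

abbreviation radius :: "nat \<Rightarrow> real" where
  "radius b \<equiv> real_of_rat (pos_rat_decode (pfst b))"

lemma radius_eq: "radius b = real (Suc (pfst (pfst b))) / real (Suc (psnd (pfst b)))"
  by (simp add: pos_rat_decode_def split_def of_rat_divide of_rat_add)

lemma radius_pos: "0 < radius b"
  unfolding radius_eq by simp

lemma ex_ball_code:
  assumes "0 < r" "r \<in> \<rat>"
  shows "\<exists>b. radius b = r \<and> psnd b = c"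
proof -
  obtain q where q: "r = of_rat q" using assms(2) by (auto elim: Rats_cases)
  then have "q \<in> range pos_rat_decode" using assms(1) unfolding pos_rat_decode_surj by simp
  then obtain n where "pos_rat_decode n = q" by auto
  then show ?thesis using q by (intro exI[of _ "prod_encode (n, c)"]) simp
qed

lemma rat_computable_in_radius [comp_intro]:
  "computable_in X f \<Longrightarrow> rat_computable_in X (\<lambda>n. radius (f n))"
  unfolding radius_eq by (intro comp_intro)

lemma rational_ball_eq:
  "rational_ball p F b = lp_ball p (lincomb F (points_decode (psnd b))) (radius b)"
  by (simp add: rational_ball_def split_def)

text \<open>\<open>act (n, m)\<close> says that the stage \<open>m\<close> is the one at which \<open>n\<close> is enumerated into \<open>C\<close>.\<close>

locale ce_enumeration =
  fixes p :: real and C :: "nat set" and act :: "nat \<Rightarrow> bool"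
  assumes p_computable: "computable_real p" and p_ge_1: "p \<ge> 1"
    and act_decidable: "decidable_in {} act"
    and act_inj: "inj_on pfst {s. act s}" and act_image: "pfst ` {s. act s} = C"
begin

text \<open>The shift by 2 keeps \<open>gam\<close> at most 1/2, so \<open>del\<close> is positive.
  Since inactive stages have weight zero, each single weight is a computable rational.\<close>

definition wt :: "nat \<Rightarrow> real" where
  "wt s = (if act s then (1 / 2) ^ (pfst s + 2) else 0)"

definition gam :: real where "gam = (\<Sum>s. wt s powr p)"

definition del :: real where "del = (1 - gam) powr (1 / p)"

definition gen :: "nat \<Rightarrow> nat \<Rightarrow> complex" where
  "gen j = (if j = 0 then (\<lambda>i. of_real (if i = 0 then del else wt (i - 1))) else std_basis j)"

lemma wt_nonneg [simp]: "0 \<le> wt s" by (simp add: wt_def)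

lemma decidable_in_act [comp_intro]: "computable_in X f \<Longrightarrow> decidable_in X (\<lambda>n. act (f n))"
  using decidable_in_comp[OF decidable_in_mono[OF act_decidable]] .

lemma rat_computable_in_wt [comp_intro]:
  "computable_in X f \<Longrightarrow> rat_computable_in X (\<lambda>n. wt (f n))"
  unfolding wt_def by (intro comp_intro)

declare p_computable [comp_intro] p_ge_1 [comp_intro]

text \<open>Each \<open>n\<close> is active in at most one stage, so reindexing by \<open>n\<close>
  leaves part of a geometric series of ratio at most 1/2.\<close>

lemma sum_wt_powr_le:
  assumes "finite A" "\<And>s. s \<in> A \<Longrightarrow> act s \<Longrightarrow> K \<le> pfst s"
  shows "(\<Sum>s\<in>A. wt s powr p) \<le> ((1 / 2) ^ (K + 1)) powr p"
proof -
  define x :: real where "x = (1 / 2) powr p"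
  have x: "0 \<le> x" "x \<le> 1 / 2"
    using powr_mono'[of 1 p "1 / 2"] p_ge_1 by (auto simp: x_def)
  have pow: "((1 / 2) ^ n) powr p = x ^ n" for n
    by (simp add: x_def powr_power powr_realpow[symmetric] powr_powr mult.commute)
  have "(\<Sum>s\<in>A. wt s powr p) = (\<Sum>s\<in>A \<inter> {s. act s}. wt s powr p)"
    using assms(1) by (intro sum.mono_neutral_right) (auto simp: wt_def)
  also have "\<dots> = (\<Sum>s\<in>A \<inter> {s. act s}. x ^ (pfst s + 2))"
    by (intro sum.cong) (auto simp: wt_def pow simp del: power_Suc)
  also have "\<dots> = (\<Sum>n\<in>pfst ` (A \<inter> {s. act s}). x ^ (n + 2))"
    using act_inj by (subst sum.reindex) (auto intro: inj_on_subset simp: o_def)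
  also have "\<dots> \<le> x ^ (K + 1)"
    using x assms by (intro sum_powers_le) auto
  finally show ?thesis by (simp only: pow)
qed

lemma summable_wt: "summable (\<lambda>s. wt s powr p)"
  by (rule summableI_nonneg_bounded) (use sum_wt_powr_le[of "{..<n}" 0 for n] in auto)

lemma gam_le_half: "gam \<le> 1 / 2"
proof -
  have "gam \<le> ((1 / 2) ^ (0 + 1)) powr p"
    unfolding gam_def by (rule suminf_le_const[OF summable_wt sum_wt_powr_le]) auto
  also have "\<dots> \<le> 1 / 2" using powr_mono'[of 1 p "1 / 2"] p_ge_1 by simp
  finally show ?thesis .
qed

lemma del_pos: "0 < del"
  using gam_le_half by (simp add: del_def)

lemma del_powr: "del powr p = 1 - gam"
  using gam_le_half p_ge_1 by (simp add: del_def powr_powr)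

lemma sum_wt_le_gam: "finite A \<Longrightarrow> (\<Sum>s\<in>A. wt s powr p) \<le> gam"
  unfolding gam_def by (intro sum_le_suminf summable_wt) auto

text \<open>Knowing that every later active stage concerns some \<open>n \<ge> K\<close> gives an
  upper bound on \<open>gam\<close>; this is how membership information about \<open>C\<close> is
  used.\<close>

lemma gam_le_sum_wt:
  assumes "\<And>s. M \<le> s \<Longrightarrow> act s \<Longrightarrow> K \<le> pfst s"
  shows "gam \<le> (\<Sum>s<M. wt s powr p) + ((1 / 2) ^ (K + 1)) powr p"
  unfolding gam_def
proof (rule suminf_le_const[OF summable_wt])
  fix n
  have "(\<Sum>s<n. wt s powr p) \<le> (\<Sum>s\<in>{..<M} \<union> {M..<n}. wt s powr p)"
    by (intro sum_mono2) auto
  also have "\<dots> = (\<Sum>s<M. wt s powr p) + (\<Sum>s\<in>{M..<n}. wt s powr p)"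
    by (intro sum.union_disjoint) auto
  also have "(\<Sum>s\<in>{M..<n}. wt s powr p) \<le> ((1 / 2) ^ (K + 1)) powr p"
    by (intro sum_wt_powr_le) (use assms in auto)
  finally show "(\<Sum>s<n. wt s powr p) \<le> (\<Sum>s<M. wt s powr p) + ((1 / 2) ^ (K + 1)) powr p" by simp
qed

lemma sum_wt_tendsto: "(\<lambda>M. \<Sum>s<M. wt s powr p) \<longlonglongrightarrow> gam"
  unfolding gam_def using summable_LIMSEQ[OF summable_wt] .

lemma gen_in_lp: "gen j \<in> lp p"
proof (cases "j = 0")
  case True
  have "summable (\<lambda>i. cmod (gen j (Suc i)) powr p)"
    using summable_wt True by (simp add: gen_def)
  then show ?thesis
    unfolding lp_def using summable_Suc_iff[of "\<lambda>i. cmod (gen j i) powr p"] by simp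
qed (simp add: gen_def std_basis_in_lp p_ge_1)

section \<open>Computability of the norm of rational combinations\<close>

lemma lincomb_gen: "lincomb gen (points_decode c) = cscale (coef c 0) (gen 0) + (coef c)(0 := 0)"
proof
  fix i
  have "lincomb gen (points_decode c) i = (\<Sum>j<Suc c. coef c j * gen j i)"
    by (simp only: lincomb_apply lessThan_Suc_atMost)
  also have "\<dots> = coef c 0 * gen 0 i + (\<Sum>j<c. coef c (Suc j) * std_basis (Suc j) i)"
    unfolding sum.lessThan_Suc_shift by (simp add: gen_def)
  also have "(\<Sum>j<c. coef c (Suc j) * std_basis (Suc j) i) = ((coef c)(0 := 0)) i"
  proof (cases i)
    case (Suc k)
    have "(\<Sum>j<c. coef c (Suc j) * std_basis (Suc j) i) = (\<Sum>j<c. if j = k then coef c (Suc j) else 0)"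
      by (intro sum.cong) (auto simp: std_basis_def Suc)
    then show ?thesis using coef_eq_0[of c i] by (auto simp: Suc)
  qed (simp add: std_basis_def)
  finally show "lincomb gen (points_decode c) i = (cscale (coef c 0) (gen 0) + (coef c)(0 := 0)) i"
    by (simp add: cscale_def)
qed

lemma lincomb_gen_0: "lincomb gen (points_decode c) 0 = of_real del * coef c 0"
  by (simp add: lincomb_gen cscale_def gen_def)

lemma lincomb_gen_Suc:
  "lincomb gen (points_decode c) (Suc s) = of_real (wt s) * coef c 0 + coef c (Suc s)"
  by (simp add: lincomb_gen cscale_def gen_def)

lemma lincomb_gen_in_lp: "lincomb gen (points_decode c) \<in> lp p"
  unfolding lincomb_gen
  by (intro Minkowski_lp(1)[OF p_ge_1] lp_cscale gen_in_lp lp_finite_support[of "Suc c"])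
    (auto simp: coef_eq_0 p_ge_1)

text \<open>Coordinate zero contributes the factor \<open>1 - gam\<close> and the tail the factor
  \<open>gam\<close> minus a finite sum, so \<open>gam\<close> cancels. The finite sum stands on the
  left, so that both sides are sums of terms with semidecidable cuts.\<close>

lemma lp_norm_lincomb_gen:
  "lp_norm p (lincomb gen (points_decode c)) powr p + (\<Sum>s<c. cmod (of_real (wt s) * coef c 0) powr p) =
     cmod (coef c 0) powr p + (\<Sum>s<c. cmod (of_real (wt s) * coef c 0 + coef c (Suc s)) powr p)"
proof -
  let ?v = "lincomb gen (points_decode c)" and ?a = "cmod (coef c 0)"
  have s: "summable (\<lambda>n. cmod (?v n) powr p)"
    using lincomb_gen_in_lp[of c] by (simp add: lp_def)
  then have s': "summable (\<lambda>n. cmod (?v (Suc n)) powr p)"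
    using summable_Suc_iff[of "\<lambda>i. cmod (?v i) powr p"] by simp
  have pow: "cmod (of_real (wt s) * coef c 0) powr p = ?a powr p * wt s powr p" for s
    by (simp add: norm_mult powr_mult)
  have "lp_norm p ?v powr p = cmod (?v 0) powr p + (\<Sum>n. cmod (?v (Suc n)) powr p)"
    unfolding lp_norm_powr[OF p_ge_1 lincomb_gen_in_lp] using suminf_split_head[OF s] by simp
  also have "(\<Sum>n. cmod (?v (Suc n)) powr p) =
      (\<Sum>n. cmod (?v (Suc (n + c))) powr p) + (\<Sum>n<c. cmod (?v (Suc n)) powr p)"
    using suminf_split_initial_segment[OF s', of c] .
  also have "(\<Sum>n. cmod (?v (Suc (n + c))) powr p) = (\<Sum>n. ?a powr p * wt (n + c) powr p)"
    unfolding lincomb_gen_Suc by (simp add: coef_eq_0 pow)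
  also have "\<dots> = ?a powr p * (gam - (\<Sum>s<c. wt s powr p))"
    unfolding gam_def suminf_split_initial_segment[OF summable_wt, of c]
    using summable_ignore_initial_segment[OF summable_wt, of c] by (simp add: suminf_mult)
  also have "cmod (?v 0) powr p = ?a powr p * (1 - gam)"
    unfolding lincomb_gen_0 del_powr[symmetric] using del_pos by (simp add: norm_mult powr_mult)
  finally show ?thesis
    unfolding pow lincomb_gen_Suc sum_distrib_left[symmetric] by (simp add: algebra_simps)
qed

lemma powr_less_powr_iff: "0 \<le> x \<Longrightarrow> 0 \<le> y \<Longrightarrow> x powr p < y powr p \<longleftrightarrow> x < y"
  using p_ge_1 powr_less_mono2[of p x y] powr_mono2[of p y x] by (meson linorder_not_less zero_less_one order_less_le_trans less_imp_le)

lemma lower_semicomputable_lp_norm_lincomb_gen: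
  "lower_semicomputable_in X (\<lambda>c. lp_norm p (lincomb gen (points_decode c)))"
  "lower_semicomputable_in X (\<lambda>c. - lp_norm p (lincomb gen (points_decode c)))"
proof -
  let ?N = "\<lambda>c. lp_norm p (lincomb gen (points_decode c))"
  let ?L = "\<lambda>c. \<Sum>s<c. cmod (of_real (wt s) * coef c 0) powr p"
  let ?R = "\<lambda>c. cmod (coef c 0) powr p + (\<Sum>s<c. cmod (of_real (wt s) * coef c 0 + coef c (Suc s)) powr p)"
  have abs: "\<bar>x\<bar> powr p < ?N c powr p \<longleftrightarrow> \<bar>x\<bar> < ?N c"
    "?N c powr p < \<bar>x\<bar> powr p \<longleftrightarrow> ?N c < \<bar>x\<bar>" for x c
    by (auto intro!: powr_less_powr_iff simp: lp_norm_nonneg)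
  have "x < ?N c \<longleftrightarrow> x < 0 \<or> \<bar>x\<bar> powr p + ?L c < ?R c" for x c
    unfolding lp_norm_lincomb_gen[of c, symmetric] using abs(1)[of x c] lp_norm_nonneg[of p "lincomb gen (points_decode c)"]
    by auto
  moreover have "semidecidable_in X (\<lambda>w. rdec (psnd w) < 0 \<or>
      \<bar>rdec (psnd w)\<bar> powr p + ?L (pfst w) < ?R (pfst w))"
    by (intro comp_intro semidecidable_in_decidable semidecidable_in_real_less)
  ultimately show "lower_semicomputable_in X ?N"
    unfolding lower_semicomputable_in_def by simp
  have "x < - ?N c \<longleftrightarrow> x < 0 \<and> ?R c < \<bar>x\<bar> powr p + ?L c" for x c
    unfolding lp_norm_lincomb_gen[of c, symmetric] using abs(2)[of c x] lp_norm_nonneg[of p "lincomb gen (points_decode c)"]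
    by auto
  moreover have "semidecidable_in X (\<lambda>w. rdec (psnd w) < 0 \<and>
      ?R (pfst w) < \<bar>rdec (psnd w)\<bar> powr p + ?L (pfst w))"
    by (intro comp_intro semidecidable_in_decidable semidecidable_in_real_less)
  ultimately show "lower_semicomputable_in X (\<lambda>c. - ?N c)"
    unfolding lower_semicomputable_in_def by simp
qed

text \<open>Both error inequalities are semidecidable and rationals are dense, so the search for an
  approximation always succeeds.\<close>

lemma lp_norm_lincomb_gen_computable:
  "\<exists>\<phi>. partrec \<phi> \<and> (\<forall>c k. \<exists>m. \<phi> (prod_encode (c, k)) = Some m \<and>
     \<bar>rdec m - lp_norm p (lincomb gen (points_decode c))\<bar> < 1 / 2 ^ k)"
proof -
  let ?N = "\<lambda>c. lp_norm p (lincomb gen (points_decode c))"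
  let ?P = "\<lambda>w m. rdec m - (1 / 2) ^ psnd w < ?N (pfst w) \<and> - (rdec m + (1 / 2) ^ psnd w) < - ?N (pfst w)"
  have "semidecidable_in {} (\<lambda>v. ?P (pfst v) (psnd v))"
    by (intro semidecidable_in_conj semidecidable_in_rat_less
        lower_semicomputable_in_comp[OF lower_semicomputable_lp_norm_lincomb_gen(1)]
        lower_semicomputable_in_comp[OF lower_semicomputable_lp_norm_lincomb_gen(2)] comp_intro)
  then obtain \<phi> where \<phi>: "partrec \<phi>" "\<And>w m. \<phi> w = Some m \<Longrightarrow> ?P w m" "\<And>w. \<exists>m. ?P w m \<Longrightarrow> \<exists>m. \<phi> w = Some m"
    by (rule semidecidable_in_uniformize[where P = ?P]) auto
  have "\<exists>m. \<phi> (prod_encode (c, k)) = Some m \<and> \<bar>rdec m - ?N c\<bar> < 1 / 2 ^ k" for c k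
  proof -
    have "?N c - (1 / 2) ^ k < ?N c + (1 / 2) ^ k" by simp
    from ex_rdec_between[OF this] obtain m where "\<phi> (prod_encode (c, k)) = Some m"
      using \<phi>(3)[of "prod_encode (c, k)"] by (fastforce simp: algebra_simps)
    with \<phi>(2)[OF this] show ?thesis by (auto simp: power_one_over)
  qed
  with \<phi>(1) show ?thesis by blast
qed

section \<open>Computing the identity map with \<open>C\<close> as oracle\<close>

text \<open>Certifies that \<open>t\<close> is close to \<open>1 / del\<close> and that
  \<open>M\<close> stages suffice. The first group is decidable in \<open>C\<close> for rational
  data; the two comparisons after it are semidecidable and enclose \<open>(t * del) powr p\<close>,
  with a partial sum in place of \<open>gam\<close>.\<close>

definition approximates :: "nat \<Rightarrow> nat \<Rightarrow> real \<Rightarrow> real \<Rightarrow> bool" where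
  "approximates K M t \<eta> \<longleftrightarrow> (0 < t \<and> 0 < \<eta> \<and> \<eta> < 1 \<and>
       (\<forall>n<K. n \<in> C \<longrightarrow> (\<exists>s<M. act s \<and> pfst s = n)) \<and> t * (1 / 2) ^ (K + 1) < \<eta>) \<and>
     \<bar>1 - \<eta>\<bar> powr p + (\<Sum>s<M. \<bar>t * wt s\<bar> powr p) + \<bar>\<eta>\<bar> powr p < \<bar>t\<bar> powr p \<and>
     \<bar>t\<bar> powr p < \<bar>1 + \<eta>\<bar> powr p + (\<Sum>s<M. \<bar>t * wt s\<bar> powr p)"

lemma sum_scaled_wt: "0 < t \<Longrightarrow> (\<Sum>s<M. \<bar>t * wt s\<bar> powr p) = t powr p * (\<Sum>s<M. wt s powr p)"
  by (simp add: abs_mult powr_mult sum_distrib_left)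

text \<open>The weights beyond \<open>M\<close> scaled by \<open>t\<close> cost at most
  \<open>\<eta> powr p\<close>. The extra summand in the lower comparison absorbs this error, while
  the upper one survives replacing the partial sum by \<open>gam\<close>.\<close>

lemma approximates_bounds:
  assumes "approximates K M t \<eta>"
  shows "\<bar>1 - t * del\<bar> \<le> \<eta>" and "t powr p * (gam - (\<Sum>s<M. wt s powr p)) \<le> \<eta> powr p"
proof -
  let ?S = "\<Sum>s<M. wt s powr p"
  have t: "0 < t" "0 < \<eta>" "\<eta> < 1" "t * (1 / 2) ^ (K + 1) < \<eta>"
    and good: "\<And>n. n < K \<Longrightarrow> n \<in> C \<Longrightarrow> \<exists>s<M. act s \<and> pfst s = n"
    and lower: "(1 - \<eta>) powr p + t powr p * ?S + \<eta> powr p < t powr p"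
    and upper: "t powr p < (1 + \<eta>) powr p + t powr p * ?S"
    using assms sum_scaled_wt[of t M] unfolding approximates_def by auto
  \<comment> \<open>An active stage past \<open>M\<close> for some \<open>n < K\<close> would be a
    second active stage of that \<open>n\<close>.\<close>
  have "K \<le> pfst s" if "M \<le> s" "act s" for s
  proof (rule ccontr)
    assume "\<not> K \<le> pfst s"
    moreover have "pfst s \<in> C" using act_image that(2) by blast
    ultimately obtain s' where "s' < M" "act s'" "pfst s' = pfst s" using good[of "pfst s"] by auto
    then show False using inj_onD[OF act_inj, of s' s] that by auto
  qed
  then have "gam - ?S \<le> ((1 / 2) ^ (K + 1)) powr p"
    using gam_le_sum_wt[of M K] by simp
  then have "t powr p * (gam - ?S) \<le> t powr p * ((1 / 2) ^ (K + 1)) powr p"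
    by (intro mult_left_mono) auto
  also have "\<dots> = (t * (1 / 2) ^ (K + 1)) powr p"
    using t(1) by (intro powr_mult[symmetric])
  also have "\<dots> \<le> \<eta> powr p"
    using t p_ge_1 by (intro powr_mono2) auto
  finally show tail: "t powr p * (gam - ?S) \<le> \<eta> powr p" .
  have td: "(t * del) powr p = t powr p * (1 - gam)"
    using t(1) del_pos by (simp add: powr_mult del_powr)
  have "(1 - \<eta>) powr p < (t * del) powr p"
    using lower tail unfolding td by (simp add: algebra_simps)
  then have "1 - \<eta> < t * del"
    using t del_pos by (subst (asm) powr_less_powr_iff) auto
  moreover have "t powr p * ?S \<le> t powr p * gam"
    by (intro mult_left_mono sum_wt_le_gam) auto
  then have "(t * del) powr p < (1 + \<eta>) powr p"
    using upper unfolding td by (simp add: algebra_simps)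
  then have "t * del < 1 + \<eta>"
    using t del_pos by (subst (asm) powr_less_powr_iff) auto
  ultimately show "\<bar>1 - t * del\<bar> \<le> \<eta>" by simp
qed

lemma ex_approximates:
  assumes "0 < \<eta>" "\<eta> < 1"
  shows "\<exists>K M t. approximates K M (rdec t) \<eta> \<and> M0 \<le> M"
proof -
  \<comment> \<open>Taking \<open>t\<close> slightly above \<open>1 / del\<close> makes
    \<open>t * del\<close> exceed 1, which gives the strict lower comparison.\<close>
  have "1 / del < (1 + \<eta>) / del"
    using del_pos assms by (simp add: divide_strict_right_mono)
  then obtain c where c: "1 / del < rdec c" "rdec c < (1 + \<eta>) / del"
    using ex_rdec_between by blast
  define t where "t = rdec c"
  have "0 < 1 / del" using del_pos by simp
  then have t: "0 < t" "1 < t * del" "t * del < 1 + \<eta>"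
    using c del_pos unfolding t_def by (linarith, simp_all add: field_simps)
  have td: "(t * del) powr p = t powr p * (1 - gam)"
    using t(1) del_pos by (simp add: powr_mult del_powr)
  have td1: "1 < t powr p * (1 - gam)" "t powr p * (1 - gam) < (1 + \<eta>) powr p"
    using powr_less_powr_iff[of 1 "t * del"] powr_less_powr_iff[of "t * del" "1 + \<eta>"] t assms
    unfolding td by auto
  have "\<exists>K. (1 / 2) ^ K < \<eta> / t"
    by (rule real_arch_pow_inv) (use t assms in auto)
  then obtain K where "(1 / 2) ^ K < \<eta> / t" ..
  then have K: "t * (1 / 2) ^ (K + 1) < \<eta>"
    using t(1) assms(1) by (simp add: field_simps)
  have "\<forall>n. \<exists>s. n \<in> C \<longrightarrow> act s \<and> pfst s = n"
    using act_image by blast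
  then obtain st where st: "\<And>n. n \<in> C \<Longrightarrow> act (st n) \<and> pfst (st n) = n"
    by metis
  have "(\<lambda>M. (1 + \<eta>) powr p + t powr p * (\<Sum>s<M. wt s powr p)) \<longlonglongrightarrow> (1 + \<eta>) powr p + t powr p * gam"
    by (intro tendsto_intros sum_wt_tendsto)
  moreover have "t powr p < (1 + \<eta>) powr p + t powr p * gam"
    using td1 by (simp add: algebra_simps)
  ultimately have "\<forall>\<^sub>F M in sequentially. t powr p < (1 + \<eta>) powr p + t powr p * (\<Sum>s<M. wt s powr p)"
    by (rule order_tendstoD)
  then obtain M1 where M1: "\<And>M. M1 \<le> M \<Longrightarrow> t powr p < (1 + \<eta>) powr p + t powr p * (\<Sum>s<M. wt s powr p)"
    unfolding eventually_sequentially by blast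
  \<comment> \<open>The summands provide for the requested bound, the upper comparison, and the
    stages of all elements of \<open>C\<close> below \<open>K\<close>.\<close>
  define M where "M = M0 + M1 + Suc (\<Sum>n<K. st n)"
  have "st n < M" if "n < K" for n
    using that member_le_sum[of n "{..<K}" st] by (simp add: M_def)
  then have "\<forall>n<K. n \<in> C \<longrightarrow> (\<exists>s<M. act s \<and> pfst s = n)"
    using st by blast
  moreover have "t powr p < (1 + \<eta>) powr p + t powr p * (\<Sum>s<M. wt s powr p)"
    by (rule M1) (simp add: M_def)
  moreover have "(1 - \<eta>) powr p + t powr p * (\<Sum>s<M. wt s powr p) + \<eta> powr p < t powr p"
  proof -
    \<comment> \<open>For \<open>p \<ge> 1\<close> the two powers add up to at most 1, which is
      below \<open>(t * del) powr p\<close>.\<close>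
    have "(1 - \<eta>) powr p \<le> (1 - \<eta>) powr 1" "\<eta> powr p \<le> \<eta> powr 1"
      using assms p_ge_1 by (intro powr_mono'; simp)+
    moreover have "t powr p * (\<Sum>s<M. wt s powr p) \<le> t powr p * gam"
      by (intro mult_left_mono sum_wt_le_gam) auto
    ultimately show ?thesis
      using td1(1) assms by (simp add: algebra_simps)
  qed
  ultimately have "approximates K M t \<eta>"
    unfolding approximates_def sum_scaled_wt[OF t(1)] using t assms K by simp
  moreover have "M0 \<le> M" by (simp add: M_def)
  ultimately show ?thesis unfolding t_def by blast
qed

text \<open>
  Coordinates with respect to \<open>gen\<close>: the vector \<open>e\<^sub>0\<close> is replaced by \<open>t\<close> times \<open>gen 0\<close> with its
  first \<open>M\<close> weights subtracted, which is close to \<open>e\<^sub>0\<close> when \<open>t \<approx> 1 / del\<close>.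
\<close>

definition translated :: "nat \<Rightarrow> nat \<Rightarrow> real \<Rightarrow> nat \<Rightarrow> complex" where
  "translated c M t j =
     (if j = 0 then of_real t * coef c 0
      else if j \<le> M then coef c j - of_real (t * wt (j - 1)) * coef c 0 else 0)"

text \<open>The first \<open>M\<close> weights cancel exactly. What remains is the error in
  coordinate zero and the tail of the weights, each of relative cost at most
  \<open>\<eta> powr p\<close>; the factor 2 is then bounded by \<open>2 powr p\<close>.\<close>

lemma lp_norm_translated_le:
  assumes "approximates K M t \<eta>" "c \<le> M" "\<And>j. coef c' j = translated c M t j"
  shows "lp_norm p (coef c - lincomb gen (points_decode c')) \<le> 2 * \<eta> * cmod (coef c 0)"
proof -
  let ?a = "cmod (coef c 0)" and ?v = "coef c - lincomb gen (points_decode c')"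
  have t: "0 < t" "0 < \<eta>" using assms(1) by (auto simp: approximates_def)
  have v: "?v \<in> lp p" by (intro lp_diff p_ge_1 coef_in_lp lincomb_gen_in_lp)
  have v0: "?v 0 = of_real (1 - t * del) * coef c 0"
    unfolding minus_apply lincomb_gen_0 by (simp add: assms(3) translated_def algebra_simps)
  have vS: "?v (Suc s) = (if s < M then 0 else - (of_real (t * wt s) * coef c 0))" for s
    unfolding minus_apply lincomb_gen_Suc using coef_eq_0[of c "Suc s"] assms(2)
    by (simp add: assms(3) translated_def algebra_simps)
  have s: "summable (\<lambda>n. cmod (?v n) powr p)" using v by (simp add: lp_def)
  then have s': "summable (\<lambda>n. cmod (?v (Suc n)) powr p)"
    using summable_Suc_iff[of "\<lambda>i. cmod (?v i) powr p"] by blast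
  have "(\<Sum>n. cmod (?v n) powr p) = cmod (?v 0) powr p + (\<Sum>n. cmod (?v (Suc n)) powr p)"
    using suminf_split_head[OF s] by simp
  also have "(\<Sum>n. cmod (?v (Suc n)) powr p) =
      (\<Sum>n. cmod (?v (Suc (n + M))) powr p) + (\<Sum>n<M. cmod (?v (Suc n)) powr p)"
    using suminf_split_initial_segment[OF s', of M] .
  also have "(\<Sum>n<M. cmod (?v (Suc n)) powr p) = 0"
    unfolding vS using p_ge_1 by simp
  also have "(\<Sum>n. cmod (?v (Suc (n + M))) powr p) = (\<Sum>n. (?a powr p * t powr p) * wt (n + M) powr p)"
    unfolding vS using t by (simp add: norm_mult powr_mult abs_mult mult_ac)
  also have "\<dots> = ?a powr p * (t powr p * (gam - (\<Sum>s<M. wt s powr p)))"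
    unfolding gam_def suminf_split_initial_segment[OF summable_wt, of M]
    using summable_ignore_initial_segment[OF summable_wt, of M] by (simp add: suminf_mult mult.assoc)
  also have "cmod (?v 0) powr p = ?a powr p * \<bar>1 - t * del\<bar> powr p"
    unfolding v0 norm_mult norm_of_real by (simp add: powr_mult mult.commute)
  finally have "(\<Sum>n. cmod (?v n) powr p) =
      ?a powr p * (\<bar>1 - t * del\<bar> powr p + t powr p * (gam - (\<Sum>s<M. wt s powr p)))"
    by (simp add: distrib_left)
  also have "\<dots> \<le> ?a powr p * (\<eta> powr p + \<eta> powr p)"
    using approximates_bounds[OF assms(1)] p_ge_1
    by (intro mult_left_mono add_mono powr_mono2) auto
  also have "\<dots> \<le> ?a powr p * (2 powr p * \<eta> powr p)"
    using powr_mono[of 1 p 2] p_ge_1 mult_right_mono[of 2 "2 powr p" "\<eta> powr p"]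
    by (intro mult_left_mono) auto
  also have "\<dots> = (2 * \<eta> * ?a) powr p"
    using t by (simp add: powr_mult mult_ac)
  finally show ?thesis
    using lp_norm_le_iff[OF p_ge_1 v, of "2 * \<eta> * ?a"] t by simp
qed

text \<open>The doubled radius compensates for moving the center by at most the old radius. Squares
  keep the error test rational, and comparing coefficients up to \<open>psnd b' + M\<close> suffices
  because both sequences vanish beyond.\<close>

definition ball_image :: "nat \<Rightarrow> nat \<Rightarrow> bool" where
  "ball_image b b' \<longleftrightarrow> radius b' = 2 * radius b \<and>
     (\<exists>K. \<exists>M. \<exists>t. \<exists>h. approximates K M (rdec t) (rdec h) \<and> psnd b \<le> M \<and>
        (2 * rdec h)\<^sup>2 * ((Re (coef (psnd b) 0))\<^sup>2 + (Im (coef (psnd b) 0))\<^sup>2) \<le> (radius b)\<^sup>2 \<and>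
        (\<forall>j<Suc (psnd b' + M). coef (psnd b') j = translated (psnd b) M (rdec t) j))"

lemma semidecidable_ball_image: "semidecidable_in C (\<lambda>w. ball_image (pfst w) (psnd w))"
proof -
  have Re_Im: "rat_computable_in C (\<lambda>n. Re (coef (f n) (g n)))" "rat_computable_in C (\<lambda>n. Im (coef (f n) (g n)))"
    if "computable_in C f" "computable_in C g" for f g
    using complex_rat_computable_in_coef[OF that] unfolding complex_rat_computable_in_def by auto
  show ?thesis
    unfolding ball_image_def approximates_def translated_def
    apply (rule semidecidable_in_conj)
     apply (rule semidecidable_in_decidable, intro comp_intro)
    apply (intro semidecidable_in_ex)
    apply (rule semidecidable_in_conj)
     apply (rule semidecidable_in_conj)
      apply (rule semidecidable_in_decidable, intro comp_intro)
     apply (intro semidecidable_in_conj semidecidable_in_real_less comp_intro)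
    apply (rule semidecidable_in_decidable, intro comp_intro Re_Im)
    done
qed

lemma ball_imageD:
  assumes "ball_image b b'"
  shows "radius b' = 2 * radius b"
    and "lp_norm p (coef (psnd b) - lincomb gen (points_decode (psnd b'))) \<le> radius b"
proof -
  let ?c = "psnd b" and ?c' = "psnd b'"
  show "radius b' = 2 * radius b" using assms by (simp add: ball_image_def)
  obtain K M t h where h: "approximates K M (rdec t) (rdec h)" "?c \<le> M"
      "(2 * rdec h)\<^sup>2 * ((Re (coef ?c 0))\<^sup>2 + (Im (coef ?c 0))\<^sup>2) \<le> (radius b)\<^sup>2"
      "\<And>j. j < Suc (?c' + M) \<Longrightarrow> coef ?c' j = translated ?c M (rdec t) j"
    using assms unfolding ball_image_def by blast
  have "coef ?c' j = translated ?c M (rdec t) j" for j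
    using h(4)[of j] coef_eq_0[of ?c' j] by (cases "j < Suc (?c' + M)") (auto simp: translated_def)
  then have "lp_norm p (coef ?c - lincomb gen (points_decode ?c')) \<le> 2 * rdec h * cmod (coef ?c 0)"
    by (intro lp_norm_translated_le[OF h(1,2)])
  also have "(2 * rdec h * cmod (coef ?c 0))\<^sup>2 \<le> (radius b)\<^sup>2"
    using h(3) by (simp add: power_mult_distrib cmod_power2)
  then have "2 * rdec h * cmod (coef ?c 0) \<le> radius b"
    using radius_pos[of b] by (meson less_imp_le power2_le_imp_le)
  finally show "lp_norm p (coef ?c - lincomb gen (points_decode ?c')) \<le> radius b" .
qed

lemma ex_ball_image: "\<exists>b'. ball_image b b'"
proof -
  let ?c = "psnd b"
  \<comment> \<open>This bound on \<open>h\<close> yields the required error. The added 1 covers a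
    zero coefficient, and the minimum keeps \<open>h\<close> below 1.\<close>
  have "0 < min 1 (radius b / (2 * (cmod (coef ?c 0) + 1)))"
    using radius_pos[of b] by (simp add: add_nonneg_pos)
  from ex_rdec_between[OF this] obtain h where h: "0 < rdec h" "rdec h < 1"
      "rdec h < radius b / (2 * (cmod (coef ?c 0) + 1))"
    by auto
  have "0 < 2 * (cmod (coef ?c 0) + 1)" by (simp add: add_nonneg_pos)
  from h(3) have "rdec h * (2 * (cmod (coef ?c 0) + 1)) < radius b"
    using pos_less_divide_eq[OF \<open>0 < 2 * (cmod (coef ?c 0) + 1)\<close>] by blast
  moreover have "rdec h * (2 * (cmod (coef ?c 0) + 1)) = 2 * rdec h * cmod (coef ?c 0) + 2 * rdec h"
    by (simp add: algebra_simps)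
  ultimately have "2 * rdec h * cmod (coef ?c 0) \<le> radius b"
    using h(1) by linarith
  then have "(2 * rdec h * cmod (coef ?c 0))\<^sup>2 \<le> (radius b)\<^sup>2"
    using h(1) by (intro power_mono) auto
  then have small: "(2 * rdec h)\<^sup>2 * ((Re (coef ?c 0))\<^sup>2 + (Im (coef ?c 0))\<^sup>2) \<le> (radius b)\<^sup>2"
    by (simp add: power_mult_distrib cmod_power2)
  obtain K M t where M: "approximates K M (rdec t) (rdec h)" "?c \<le> M"
    using ex_approximates[OF h(1,2)] by blast
  have rat: "Re (translated ?c M (rdec t) j) \<in> \<rat> \<and> Im (translated ?c M (rdec t) j) \<in> \<rat>" for j
    using coef_rational by (auto simp: translated_def wt_def intro!: Rats_mult Rats_diff Rats_power)
  have "\<exists>c'. \<forall>j. coef c' j = translated ?c M (rdec t) j"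
    by (rule ex_coef[OF rat, of M]) (simp add: translated_def)
  then obtain c' where c': "\<And>j. coef c' j = translated ?c M (rdec t) j" by blast
  obtain b' where "radius b' = 2 * radius b" "psnd b' = c'"
    using ex_ball_code[of "2 * radius b" c'] radius_pos[of b] by auto
  then show ?thesis
    unfolding ball_image_def using M small c' by (intro exI[of _ b']) auto
qed

lemma generating_set_gen: "generating_set p gen"
  unfolding generating_set_def
proof (intro conjI ballI allI impI)
  show "range gen \<subseteq> lp p" using gen_in_lp by blast
  fix a \<epsilon> assume a: "a \<in> lp p" and "(0 :: real) < \<epsilon>"
  then have e2: "0 < \<epsilon> / 2" by simp
  obtain c where c: "lp_norm p (a - coef c) < \<epsilon> / 2"
    using ex_coef_near[OF p_ge_1 a e2] by blast
  obtain r where r: "r \<in> \<rat>" "0 < r" "r < \<epsilon> / 2" using Rats_dense_in_real[OF e2] by blast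
  obtain b where b: "radius b = r" "psnd b = c" using ex_ball_code[OF r(2,1)] by blast
  obtain b' where "ball_image b b'" using ex_ball_image by blast
  define g where "g = lincomb gen (points_decode (psnd b'))"
  have "lp_norm p (coef c - g) \<le> r"
    using ball_imageD(2)[OF \<open>ball_image b b'\<close>] by (simp add: b g_def)
  moreover have "lp_norm p (a - g) \<le> lp_norm p (a - coef c) + lp_norm p (coef c - g)"
    unfolding g_def by (intro lp_norm_triangle p_ge_1 a coef_in_lp lincomb_gen_in_lp)
  moreover have "g \<in> cseq.span (range gen)"
    unfolding g_def lincomb_def
    by (intro cseq.span_sum cseq.span_scale cseq.span_base) auto
  ultimately show "\<exists>b\<in>cseq.span (range gen). lp_norm p (a - b) < \<epsilon>"
    using c r by (intro bexI[of _ g]) auto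
qed

text \<open>The image ball contains the given ball by the triangle inequality, and its radius is
  only twice as large, so small input balls give small output balls.\<close>

lemma computes_map_id: "computes_map p C std_basis gen id"
proof -
  obtain \<phi> where \<phi>: "partrec_in C \<phi>" "\<And>b b'. \<phi> b = Some b' \<Longrightarrow> ball_image b b'"
      "\<And>b. \<exists>b'. \<phi> b = Some b'"
    using semidecidable_in_uniformize[OF semidecidable_ball_image] ex_ball_image by metis
  let ?E = "\<lambda>b. coef (psnd b)" and ?F = "\<lambda>b. lincomb gen (points_decode (psnd b))"
  have "id f \<in> rational_ball p gen b'" if "\<phi> b = Some b'" "f \<in> rational_ball p std_basis b" for b b' f
  proof -
    have f: "f \<in> lp p" "lp_norm p (f - ?E b) < radius b"
      using that(2) by (auto simp: rational_ball_eq lincomb_std_basis lp_ball_def)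
    have "lp_norm p (f - ?F b') \<le> lp_norm p (f - ?E b) + lp_norm p (?E b - ?F b')"
      by (intro lp_norm_triangle p_ge_1 f coef_in_lp lincomb_gen_in_lp)
    then show ?thesis
      using ball_imageD[OF \<phi>(2)[OF that(1)]] f by (simp add: rational_ball_eq lp_ball_def)
  qed
  moreover have "\<exists>b b'. f \<in> rational_ball p std_basis b \<and> \<phi> b = Some b' \<and> rational_ball p gen b' \<subseteq> U"
    if f: "f \<in> lp p" and U: "\<exists>\<epsilon>>0. lp_ball p (id f) \<epsilon> \<subseteq> U" for f U
  proof -
    obtain \<epsilon> where e: "0 < \<epsilon>" "lp_ball p f \<epsilon> \<subseteq> U" using U by auto
    \<comment> \<open>A point of the image ball is within \<open>2 * r\<close> of its center, that
      center within \<open>r\<close> of the old one, and the old one within \<open>r\<close> of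
      \<open>f\<close>.\<close>
    then have "0 < \<epsilon> / 4" by simp
    from Rats_dense_in_real[OF this] obtain r where r: "r \<in> \<rat>" "0 < r" "r < \<epsilon> / 4" by blast
    obtain c where c: "lp_norm p (f - coef c) < r" using ex_coef_near[OF p_ge_1 f r(2)] by blast
    obtain b where b: "radius b = r" "psnd b = c" using ex_ball_code[OF r(2,1)] by blast
    obtain b' where b': "\<phi> b = Some b'" using \<phi>(3) by blast
    have "rational_ball p gen b' \<subseteq> lp_ball p f \<epsilon>"
    proof
      fix g assume "g \<in> rational_ball p gen b'"
      then have g: "g \<in> lp p" "lp_norm p (g - ?F b') < 2 * r"
        using ball_imageD(1)[OF \<phi>(2)[OF b']] by (auto simp: rational_ball_eq lp_ball_def b)
      have "lp_norm p (g - f) \<le> lp_norm p (g - ?F b') + lp_norm p (?F b' - f)"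
        by (intro lp_norm_triangle p_ge_1 f g lincomb_gen_in_lp)
      also have "lp_norm p (?F b' - f) \<le> lp_norm p (?F b' - coef c) + lp_norm p (coef c - f)"
        by (intro lp_norm_triangle p_ge_1 f coef_in_lp lincomb_gen_in_lp)
      also have "lp_norm p (?F b' - coef c) \<le> r"
        using ball_imageD(2)[OF \<phi>(2)[OF b']] by (simp add: b lp_norm_minus_commute[of p "?F b'"])
      also have "lp_norm p (coef c - f) < r"
        using c by (simp add: lp_norm_minus_commute[of p f])
      finally have "lp_norm p (g - f) < \<epsilon>"
        using g r by linarith
      with g show "g \<in> lp_ball p f \<epsilon>"
        by (simp add: lp_ball_def)
    qed
    moreover have "f \<in> rational_ball p std_basis b"
      using f c by (simp add: rational_ball_eq lincomb_std_basis lp_ball_def b)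
    ultimately show ?thesis using b' e by blast
  qed
  ultimately show ?thesis
    unfolding computes_map_def using \<phi>(1) by blast
qed

section \<open>Recovering \<open>C\<close> from an oracle for an isometry\<close>

text \<open>Beyond \<open>psnd b + j\<close> both vectors vanish, so membership is a comparison
  involving a finite sum and hence semidecidable.\<close>

lemma std_basis_mem_rational_ball_iff:
  "std_basis j \<in> rational_ball p std_basis b \<longleftrightarrow>
     (\<Sum>i<Suc (psnd b + j). cmod (coef (psnd b) i - (if i = j then 1 else 0)) powr p) < \<bar>radius b\<bar> powr p"
proof -
  let ?v = "std_basis j - coef (psnd b)"
  have v: "?v \<in> lp p" by (intro lp_diff p_ge_1 std_basis_in_lp coef_in_lp)
  have "(\<Sum>i. cmod (?v i) powr p) = (\<Sum>i<Suc (psnd b + j). cmod (?v i) powr p)"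
    by (rule suminf_finite) (auto simp: coef_eq_0 std_basis_def)
  also have "\<dots> = (\<Sum>i<Suc (psnd b + j). cmod (coef (psnd b) i - (if i = j then 1 else 0)) powr p)"
    by (intro sum.cong) (auto simp: std_basis_def norm_minus_commute)
  finally show ?thesis
    unfolding rational_ball_eq lp_ball_def lincomb_std_basis mem_Collect_eq
    using lp_norm_less_iff[OF p_ge_1 v, of "radius b"] radius_pos[of b] std_basis_in_lp[OF p_ge_1]
    by (simp add: less_imp_le)
qed

text \<open>Convergence only speaks of balls as sets, whereas the search sees their radii. The
  center and its translate by half the radius along \<open>std_basis 0\<close> must both lie within
  \<open>\<epsilon>\<close> of \<open>g\<close>.\<close>

lemma radius_le_of_subset_ball:
  assumes "rational_ball p gen b \<subseteq> lp_ball p g \<epsilon>" "g \<in> lp p"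
  shows "radius b \<le> 4 * \<epsilon>"
proof -
  let ?m = "lincomb gen (points_decode (psnd b))" and ?u = "cscale (of_real (radius b / 2)) (std_basis 0)"
  have m: "?m \<in> lp p" by (rule lincomb_gen_in_lp)
  have u: "?u \<in> lp p" "lp_norm p ?u = radius b / 2"
    using radius_pos[of b]
    by (auto simp: lp_cscale std_basis_in_lp p_ge_1 lp_norm_cscale lp_norm_std_basis norm_divide)
  have mu: "?m + ?u \<in> lp p" by (rule Minkowski_lp(1)[OF p_ge_1 m u(1)])
  have "?m \<in> rational_ball p gen b"
    using m radius_pos[of b] p_ge_1 by (simp add: rational_ball_eq lp_ball_def lp_norm_def)
  moreover have "lp_norm p ?u < radius b"
    using u(2) radius_pos[of b] by linarith
  then have "?m + ?u \<in> rational_ball p gen b"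
    using mu by (simp add: rational_ball_eq lp_ball_def)
  ultimately have near: "lp_norm p (?m - g) < \<epsilon>" "lp_norm p (?m + ?u - g) < \<epsilon>"
    using assms(1) by (auto simp: lp_ball_def)
  have "radius b / 2 = lp_norm p (?m + ?u - ?m)" using u(2) by simp
  also have "\<dots> \<le> lp_norm p (?m + ?u - g) + lp_norm p (g - ?m)"
    by (intro lp_norm_triangle p_ge_1 mu m assms)
  finally show ?thesis
    using near by (simp add: lp_norm_minus_commute[of p g])
qed

text \<open>If \<open>n\<close> belongs to \<open>C\<close> but is not enumerated before
  \<open>M\<close>, the partial sum plus the weight power of \<open>n\<close> is at most
  \<open>gam\<close>. An image ball of small radius gives an upper bound on \<open>gam\<close> that
  can refute this.\<close>

lemma semidecidable_in_compl:
  assumes T: "surj_linear_isometry p T" "computes_map p X std_basis gen T" and "p \<noteq> 2"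
  shows "semidecidable_in X (\<lambda>n. n \<notin> C)"
proof -
  obtain \<phi> where \<phi>: "partrec_in X \<phi>"
      "\<And>b b' f. \<phi> b = Some b' \<Longrightarrow> f \<in> rational_ball p std_basis b \<Longrightarrow> T f \<in> rational_ball p gen b'"
      "\<And>f \<epsilon>. f \<in> lp p \<Longrightarrow> 0 < \<epsilon> \<Longrightarrow> \<exists>b b'. f \<in> rational_ball p std_basis b \<and> \<phi> b = Some b' \<and>
         rational_ball p gen b' \<subseteq> lp_ball p (T f) \<epsilon>"
    using T(2) unfolding computes_map_def by (metis order_refl)
  obtain j u where u: "cmod u = 1" "T (std_basis j) = cscale u (std_basis 0)"
    by (rule surj_linear_isometry_preimage_std_basis[OF T(1) p_ge_1 assms(3)])
  define \<beta> where "\<beta> b = coef (psnd b) 0" for b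
  \<comment> \<open>Coordinate zero of the image of \<open>std_basis j\<close> has modulus 1, while
    that of the center is \<open>del\<close> times the coefficient of \<open>gen 0\<close>.\<close>
  have coord: "\<bar>1 - del * cmod (\<beta> b')\<bar> < radius b'"
    if "\<phi> b = Some b'" "std_basis j \<in> rational_ball p std_basis b" for b b'
  proof -
    let ?m = "lincomb gen (points_decode (psnd b'))"
    have "T (std_basis j) \<in> rational_ball p gen b'" by (rule \<phi>(2)[OF that])
    then have "T (std_basis j) \<in> lp p" "lp_norm p (T (std_basis j) - ?m) < radius b'"
      by (auto simp: rational_ball_eq lp_ball_def)
    moreover from this have "cmod ((T (std_basis j) - ?m) 0) \<le> lp_norm p (T (std_basis j) - ?m)"
      by (intro cmod_le_lp_norm lp_diff p_ge_1 lincomb_gen_in_lp)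
    moreover have "(T (std_basis j) - ?m) 0 = u - of_real del * \<beta> b'"
      unfolding minus_apply u(2) lincomb_gen_0 by (simp add: cscale_def std_basis_def \<beta>_def)
    ultimately have "cmod (u - of_real del * \<beta> b') < radius b'" by simp
    moreover have "\<bar>cmod u - cmod (of_real del * \<beta> b')\<bar> \<le> cmod (u - of_real del * \<beta> b')"
      by (rule norm_triangle_ineq3)
    ultimately show ?thesis using u(1) del_pos by (simp add: norm_mult)
  qed
  \<comment> \<open>With \<open>S\<close> the partial sum and \<open>d\<close> the weight power of
    \<open>n\<close>, the last comparison says that
    \<open>cmod (\<beta> b') powr p * (1 - S - d)\<close> is below
    \<open>(1 - radius b') powr p\<close>. It is multiplied out into sums with semidecidable
    cuts.\<close>
  define P where "P n \<longleftrightarrow> (\<exists>M. \<exists>b. \<exists>b'. \<phi> b = Some b' \<and>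
     (radius b' < 1 \<and> (\<forall>s<M. \<not> (act s \<and> pfst s = n))) \<and>
     (\<Sum>i<Suc (psnd b + j). cmod (coef (psnd b) i - (if i = j then 1 else 0)) powr p) < \<bar>radius b\<bar> powr p \<and>
     cmod (coef (psnd b') 0) powr p < \<bar>1 - radius b'\<bar> powr p +
       (\<Sum>s<M. cmod (of_real (wt s) * coef (psnd b') 0) powr p) +
       cmod (of_real ((1 / 2) ^ (n + 2)) * coef (psnd b') 0) powr p)" for n
  have "semidecidable_in X (\<lambda>n. P n)"
    unfolding P_def
    apply (intro semidecidable_in_ex)
    apply (rule semidecidable_in_conj)
     apply (intro comp_intro semidecidable_in_comp2[OF semidecidable_in_graph[OF \<phi>(1)]])
    apply (rule semidecidable_in_conj)
     apply (rule semidecidable_in_decidable, intro comp_intro)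
    apply (intro semidecidable_in_conj semidecidable_in_real_less comp_intro)
    done
  moreover have "P n \<longleftrightarrow> n \<notin> C" for n
  proof -
    define d where "d = ((1 / 2) ^ (n + 2)) powr p"
    have d: "0 < d" by (simp add: d_def)
    have scale: "cmod (of_real x * z) powr p = cmod z powr p * x powr p" if "0 \<le> x" for x z
      using that by (simp add: norm_mult powr_mult)
    have terms: "a + (\<Sum>s<M. cmod (of_real (wt s) * z) powr p) + cmod (of_real ((1 / 2) ^ (n + 2)) * z) powr p =
        a + cmod z powr p * ((\<Sum>s<M. wt s powr p) + d)" for a z M
      unfolding d_def scale[OF wt_nonneg] by (subst scale) (simp_all add: sum_distrib_left distrib_left)
    have P: "P n \<longleftrightarrow> (\<exists>M b b'. \<phi> b = Some b' \<and>
        (radius b' < 1 \<and> (\<forall>s<M. \<not> (act s \<and> pfst s = n))) \<and>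
        std_basis j \<in> rational_ball p std_basis b \<and>
        cmod (\<beta> b') powr p < \<bar>1 - radius b'\<bar> powr p +
          cmod (\<beta> b') powr p * ((\<Sum>s<M. wt s powr p) + d))"
      unfolding P_def std_basis_mem_rational_ball_iff \<beta>_def terms ..
    show ?thesis
    proof
      assume "P n"
      then obtain M b b' where M: "\<phi> b = Some b'" "std_basis j \<in> rational_ball p std_basis b"
          "radius b' < 1" "\<And>s. s < M \<Longrightarrow> act s \<Longrightarrow> pfst s \<noteq> n"
          "cmod (\<beta> b') powr p < \<bar>1 - radius b'\<bar> powr p + cmod (\<beta> b') powr p * ((\<Sum>s<M. wt s powr p) + d)"
        unfolding P by blast
      have abs: "\<bar>1 - radius b'\<bar> = 1 - radius b'" using M(3) by linarith
      show "n \<notin> C"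
      proof
        assume "n \<in> C"
        then obtain s where s: "act s" "pfst s = n" using act_image by blast
        have "s \<notin> {..<M}" using M(4)[of s] s by auto
        moreover have "wt s powr p = d" using s by (simp add: wt_def d_def)
        ultimately have "(\<Sum>s<M. wt s powr p) + d = (\<Sum>s\<in>insert s {..<M}. wt s powr p)"
          by simp
        also have "\<dots> \<le> gam" by (rule sum_wt_le_gam) simp
        finally have le: "cmod (\<beta> b') powr p * ((\<Sum>s<M. wt s powr p) + d) \<le> cmod (\<beta> b') powr p * gam"
          by (rule mult_left_mono) simp
        have "1 - radius b' < del * cmod (\<beta> b')"
          using coord[OF M(1,2)] by linarith
        then have "(1 - radius b') powr p < (del * cmod (\<beta> b')) powr p"
          using M(3) p_ge_1 by (intro powr_less_mono2) auto
        also have "\<dots> = cmod (\<beta> b') powr p * (1 - gam)"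
          using del_pos by (simp add: powr_mult del_powr)
        finally show False using M(5) le unfolding abs by (simp add: algebra_simps)
      qed
    next
      assume n: "n \<notin> C"
      \<comment> \<open>A factor below 1 such that lowering \<open>1 - gam\<close> by
        \<open>d / 2\<close> costs at least this factor. The strict gap leaves room for a positive
        radius.\<close>
      define \<kappa> where "\<kappa> = max 0 (1 - d / (2 * (1 - gam)))"
      have pos: "0 < 1 - gam" using gam_le_half by simp
      then have \<kappa>: "0 \<le> \<kappa>" "\<kappa> < 1" "1 - gam - d / 2 \<le> (1 - gam) * \<kappa>"
        using d by (auto simp: \<kappa>_def max_def field_simps)
      have "((\<lambda>r. (1 - r) powr p - (1 + r) powr p * \<kappa>) \<longlongrightarrow> (1 - 0) powr p - (1 + 0) powr p * \<kappa>) (at_right 0)"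
        by (intro tendsto_intros) auto
      then have "\<forall>\<^sub>F r in at_right 0. 0 < (1 - r) powr p - (1 + r) powr p * \<kappa>"
        by (rule order_tendstoD) (use \<kappa> in simp)
      then obtain \<rho> where \<rho>: "0 < \<rho>" "\<And>r. 0 < r \<Longrightarrow> r < \<rho> \<Longrightarrow> (1 + r) powr p * \<kappa> < (1 - r) powr p"
        unfolding eventually_at_right_field by auto
      define \<epsilon> where "\<epsilon> = min \<rho> 1 / 8"
      have e: "0 < \<epsilon>" "4 * \<epsilon> < \<rho>" "4 * \<epsilon> < 1" using \<rho>(1) by (auto simp: \<epsilon>_def min_def)
      obtain b b' where b: "std_basis j \<in> rational_ball p std_basis b" "\<phi> b = Some b'"
          "rational_ball p gen b' \<subseteq> lp_ball p (T (std_basis j)) \<epsilon>"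
        using \<phi>(3)[OF std_basis_in_lp[OF p_ge_1] e(1)] by blast
      have "radius b' \<le> 4 * \<epsilon>"
        by (rule radius_le_of_subset_ball[OF b(3) surj_linear_isometry_mem[OF T(1) std_basis_in_lp[OF p_ge_1]]])
      then have r: "radius b' < 1" "radius b' < \<rho>" using e by linarith+
      \<comment> \<open>Half of \<open>d\<close> pays for the missing tail; the other half makes the
        comparison strict through \<open>\<kappa>\<close>.\<close>
      have "\<forall>\<^sub>F M in sequentially. gam - d / 2 < (\<Sum>s<M. wt s powr p)"
        by (rule order_tendstoD(1)[OF sum_wt_tendsto]) (use d in simp)
      then obtain M where M: "gam - d / 2 < (\<Sum>s<M. wt s powr p)"
        unfolding eventually_sequentially by blast
      let ?B = "cmod (\<beta> b') powr p"
      have "?B * (1 - (\<Sum>s<M. wt s powr p) - d) \<le> ?B * ((1 - gam) * \<kappa>)"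
        using M \<kappa>(3) by (intro mult_left_mono) auto
      also have "\<dots> = (del * cmod (\<beta> b')) powr p * \<kappa>"
        using del_pos by (simp add: powr_mult del_powr)
      also have "\<dots> \<le> (1 + radius b') powr p * \<kappa>"
        using coord[OF b(2,1)] del_pos p_ge_1 \<kappa>(1) by (intro mult_right_mono powr_mono2) auto
      also have "\<dots> < (1 - radius b') powr p"
        by (rule \<rho>(2)[OF radius_pos r(2)])
      finally have "?B < (1 - radius b') powr p + ?B * ((\<Sum>s<M. wt s powr p) + d)"
        by (simp add: algebra_simps)
      moreover have "1 - radius b' = \<bar>1 - radius b'\<bar>" using r by linarith
      moreover have "\<forall>s<M. \<not> (act s \<and> pfst s = n)" using n act_image by blast
      ultimately show "P n" unfolding P using b r by metis
    qed
  qed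
  ultimately show ?thesis by (simp only:)
qed

end

lemma ce_imp_semidecidable_in:
  assumes "ce C"
  shows "semidecidable_in X (\<lambda>n. n \<in> C)"
proof -
  obtain \<phi> where \<phi>: "partrec \<phi>" "C = dom \<phi>" using assms unfolding ce_def by blast
  have "semidecidable_in X (\<lambda>n. \<exists>m. \<phi> n = Some m)"
    by (intro comp_intro semidecidable_in_mono[OF semidecidable_in_graph[OF \<phi>(1)]])
  then show ?thesis by (simp add: \<phi>(2) domIff)
qed

lemma ce_enumeration_exists:
  assumes "computable_real p" "p \<ge> 1" "ce C"
  shows "\<exists>act. ce_enumeration p C act"
proof -
  obtain R where R: "decidable_in {} (\<lambda>w. R (pfst w) (psnd w))" "\<And>n. n \<in> C \<longleftrightarrow> (\<exists>m. R n m)"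
    using ce_imp_semidecidable_in[OF assms(3), of "{}"] unfolding semidecidable_in_def by blast
  \<comment> \<open>Only the least witness counts, which makes each element of \<open>C\<close>
    active exactly once.\<close>
  define act where "act s \<longleftrightarrow> R (pfst s) (psnd s) \<and> (\<forall>m<psnd s. \<not> R (pfst s) m)" for s
  have "ce_enumeration p C act"
  proof
    show "decidable_in {} act"
      unfolding act_def by (intro comp_intro R(1) decidable_in_comp2[OF R(1)])
    show "inj_on pfst {s. act s}"
    proof (rule inj_onI)
      fix s t assume "s \<in> {s. act s}" "t \<in> {s. act s}" "pfst s = pfst t"
      moreover from this have "psnd s = psnd t"
        unfolding act_def mem_Collect_eq by (metis linorder_neqE_nat)
      ultimately have "prod_decode s = prod_decode t" by (simp add: prod_eq_iff)
      then show "s = t" by simp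
    qed
    show "pfst ` {s. act s} = C"
    proof (intro equalityI subsetI)
      fix n assume "n \<in> C"
      then have "\<exists>m. R n m" using R(2) by blast
      then have "act (prod_encode (n, LEAST m. R n m))"
        by (auto simp: act_def intro: LeastI_ex dest: not_less_Least)
      then show "n \<in> pfst ` {s. act s}" by (metis fst_conv image_eqI mem_Collect_eq prod_encode_inverse)
    qed (use R(2) in \<open>auto simp: act_def\<close>)
  qed (use assms in auto)
  then show ?thesis by blast
qed

theorem theorem2p3:
  fixes p :: real and C :: "nat set"
  assumes "computable_real p" and "p \<ge> 1" and "p \<noteq> 2" and "ce C"
  shows "\<exists>F. effective_generating_set p F \<and>
           (\<exists>T. surj_linear_isometry p T \<and> computes_map p C std_basis F T) \<and>
           (\<forall>X. (\<exists>T. surj_linear_isometry p T \<and> computes_map p X std_basis F T) \<longrightarrow> C \<le>\<^sub>T X)"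
proof -
  obtain act where "ce_enumeration p C act"
    using ce_enumeration_exists[OF assms(1,2,4)] by blast
  then interpret ce_enumeration p C act .
  have "effective_generating_set p gen"
    unfolding effective_generating_set_def
    using generating_set_gen lp_norm_lincomb_gen_computable by blast
  moreover have "surj_linear_isometry p id"
    by (simp add: surj_linear_isometry_def)
  \<comment> \<open>Enumerability of \<open>C\<close> supplies one half of Post's criterion, the
    isometry the other.\<close>
  moreover have "C \<le>\<^sub>T X" if "surj_linear_isometry p T" "computes_map p X std_basis gen T" for X T
    using decidable_in_Post[OF ce_imp_semidecidable_in[OF assms(4)]
        semidecidable_in_compl[OF that assms(3)]]
    unfolding turing_reducible_def decidable_in_def computable_in_def .
  ultimately show ?thesis
    using computes_map_id by blast
qed

end
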